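(* Let $m,k\ge1$ be integers and let $\alpha_{Z(m)}$ be the $m$-layer Z-shape. Then the number of dominant constraint graphs $C\in\mathcal{C}_{(\alpha_{Z(m)},2k)}$ is $$D(m,k)=\frac{1}{mk+1}\binom{(m+1)k}{k}.$$
   Context: The $m$-layer Z-shape $\alpha_{Z(m)}$ has vertices $u_1,\dots,u_m,v_1,\dots,v_m$ and edges $\{u_j,v_j\}$ ($j\in[m]$) and $\{u_{j+1},v_j\}$ ($j\in[m-1]$). The multigraph $H(\alpha_{Z(m)},2k)$: it has $2km$ vertices $a_{ij},b_{ij}$ with $i\in[k]$, $j\in[m]$. Its edges (a multiset) are, for each $i\in[k]$: $\{a_{ij},b_{ij}\}$ and $\{b_{ij},a_{(i+1)j}\}$ for $j\in[m]$, together with $\{a_{i(j+1)},b_{ij}\}$ and $\{b_{ij},a_{(i+1)(j+1)}\}$ for $j\in[m-1]$. The first index is read cyclically, so $a_{(k+1)j}=a_{1j}$ (for $k=1$ every edge is doubled). This is the cyclic gluing of $k$ copies of $\alpha_{Z(m)}$ and $k$ copies of its transpose. Its "pieces" are the vertex sets $\{a_{ij},b_{ij}:j\in[m]\}$ and $\{b_{ij},a_{(i+1)j}:j\in[m]\}$ for $i\in[k]$. A constraint graph $C$ on a vertex set $V$ is an acyclic graph on $V$; write $u\longleftrightarrow_C v$ if $u=v$ or $C$ contains a path from $u$ to $v$. Two constraint graphs are equivalent if they induce the same relation $\longleftrightarrow$; constraint graphs are considered (and counted) up to equivalence. $\mathcal{C}_{(\alpha_{Z(m)},2k)}$ is the set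 of (equivalence classes of) constraint graphs $C$ on the vertices of $H(\alpha_{Z(m)},2k)$ such that no two distinct vertices of the same piece satisfy $u\longleftrightarrow_C v$. $H/C$ is the multigraph obtained from $H$ by identifying vertices $u,v$ whenever $u\longleftrightarrow_C v$, keeping all edges with multiplicity. $\mathrm{val}(C)=1$ if every edge of $H(\alpha_{Z(m)},2k)/C$ has even multiplicity, and $\mathrm{val}(C)=0$ otherwise. $C\in\mathcal{C}_{(\alpha_{Z(m)},2k)}$ is dominant if $\mathrm{val}(C)\ne0$ and $|E(C)|$ is minimum among all $C'\in\mathcal{C}_{(\alpha_{Z(m)},2k)}$ with $\mathrm{val}(C')\ne0$. *)

theory Defs
  imports Complex_Main "HOL-Library.Multiset"
begin

text \<open>Multigraphs: the edges form a multiset of unordered pairs, represented as sets of endpoints.\<close>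

record 'v multigraph =
  verts :: "'v set"
  edges :: "'v set multiset"

text \<open>
  The shape \<open>\<alpha>\<^bsub>Z(m)\<^esub>\<close> is bipartite; a pair \<open>(p, q)\<close> in \<open>zshape m\<close> stands for the
  edge \<open>{u\<^sub>p, v\<^sub>q}\<close>.
\<close>

definition zshape :: "nat \<Rightarrow> (nat \<times> nat) set" where
  "zshape m = {(j, j) | j. j \<in> {1..m}} \<union> {(j + 1, j) | j. j \<in> {1..<m}}"

text \<open>\<open>A i j\<close> and \<open>B i j\<close> are the vertices \<open>a\<^bsub>ij\<^esub>\<close> and \<open>b\<^bsub>ij\<^esub>\<close>, with \<open>i \<in> {1..k}\<close> and \<open>j \<in> {1..m}\<close>.\<close>

datatype vertex = A nat nat | B nat nat

definition cyc_next :: "nat \<Rightarrow> nat \<Rightarrow> nat" where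
  "cyc_next k i = (if i = k then 1 else i + 1)"

definition H_verts :: "nat \<Rightarrow> nat \<Rightarrow> vertex set" where
  "H_verts m k = {A i j | i j. i \<in> {1..k} \<and> j \<in> {1..m}} \<union> {B i j | i j. i \<in> {1..k} \<and> j \<in> {1..m}}"

definition H_edges :: "nat \<Rightarrow> nat \<Rightarrow> vertex set multiset" where
  "H_edges m k = (\<Sum>i\<in>{1..k}.
     (\<Sum>j\<in>{1..m}. {# {A i j, B i j}, {B i j, A (cyc_next k i) j} #}) +
     (\<Sum>j\<in>{1..<m}. {# {A i (j + 1), B i j}, {B i j, A (cyc_next k i) (j + 1)} #}))"

text \<open>\<open>H_Z m k\<close> is the multigraph \<open>H(\<alpha>\<^bsub>Z(m)\<^esub>, 2k)\<close>.\<close>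

definition H_Z :: "nat \<Rightarrow> nat \<Rightarrow> vertex multigraph" where
  "H_Z m k = \<lparr>verts = H_verts m k, edges = H_edges m k\<rparr>"

text \<open>
  The explicit edge list is the cyclic gluing of \<open>k\<close> copies of the shape
  (from layer \<open>a\<^sub>i\<close> to layer \<open>b\<^sub>i\<close>) and \<open>k\<close> copies of its transpose
  (from layer \<open>b\<^sub>i\<close> to layer \<open>a\<^bsub>i+1\<^esub>\<close>).
\<close>

lemma H_edges_eq_gluing:
  "H_edges m k = (\<Sum>i\<in>{1..k}. \<Sum>(p, q)\<in>zshape m.
     {# {A i p, B i q}, {B i q, A (cyc_next k i) p} #})"
proof -
  have "(\<Sum>(p, q)\<in>zshape m. {# {A i p, B i q}, {B i q, A (cyc_next k i) p} #}) =
     (\<Sum>j\<in>{1..m}. {# {A i j, B i j}, {B i j, A (cyc_next k i) j} #}) +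
     (\<Sum>j\<in>{1..<m}. {# {A i (j + 1), B i j}, {B i j, A (cyc_next k i) (j + 1)} #})" for i
  proof -
    have z: "zshape m = (\<lambda>j. (j, j)) ` {1..m} \<union> (\<lambda>j. (j + 1, j)) ` {1..<m}"
      by (auto simp: zshape_def)
    have d: "(\<lambda>j. (j, j)) ` {1..m} \<inter> (\<lambda>j. (j + 1, j)) ` {1..<m} = {}"
      by auto
    show ?thesis
      unfolding z
      by (subst sum.union_disjoint[OF _ _ d]) (auto simp: sum.reindex inj_on_def)
  qed
  then show ?thesis
    by (simp add: H_edges_def)
qed

definition pieces :: "nat \<Rightarrow> nat \<Rightarrow> vertex set set" where
  "pieces m k =
     {{A i j | j. j \<in> {1..m}} \<union> {B i j | j. j \<in> {1..m}} | i. i \<in> {1..k}} \<union>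
     {{B i j | j. j \<in> {1..m}} \<union> {A (cyc_next k i) j | j. j \<in> {1..m}} | i. i \<in> {1..k}}"

text \<open>Simple graphs on a fixed vertex set are represented by their edge sets.\<close>

definition simple_graph_on :: "'v set \<Rightarrow> 'v set set \<Rightarrow> bool" where
  "simple_graph_on V C \<longleftrightarrow> (\<forall>e\<in>C. \<exists>u\<in>V. \<exists>v\<in>V. u \<noteq> v \<and> e = {u, v})"

definition is_cycle :: "'v set set \<Rightarrow> 'v list \<Rightarrow> bool" where
  "is_cycle C xs \<longleftrightarrow> length xs \<ge> 3 \<and> distinct xs \<and>
     successively (\<lambda>u v. {u, v} \<in> C) xs \<and> {last xs, hd xs} \<in> C"

definition constraint_graph :: "'v set \<Rightarrow> 'v set set \<Rightarrow> bool" where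
  "constraint_graph V C \<longleftrightarrow> simple_graph_on V C \<and> (\<nexists>xs. is_cycle C xs)"

definition conn :: "'v set \<Rightarrow> 'v set set \<Rightarrow> 'v rel" where
  "conn V C = {(u, v). u \<in> V \<and> v \<in> V \<and> (u, v) \<in> {(x, y). {x, y} \<in> C}\<^sup>*}"

definition contract :: "'v multigraph \<Rightarrow> 'v set set \<Rightarrow> 'v set multigraph" where
  "contract H C =
     \<lparr>verts = verts H // conn (verts H) C,
      edges = image_mset (\<lambda>e. (\<lambda>v. conn (verts H) C `` {v}) ` e) (edges H)\<rparr>"

definition val :: "nat \<Rightarrow> nat \<Rightarrow> vertex set set \<Rightarrow> nat" where
  "val m k C = (if \<forall>e \<in># edges (contract (H_Z m k) C). even (count (edges (contract (H_Z m k) C)) e)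
     then 1 else 0)"

text \<open>Representatives of the elements of \<open>\<C>\<^bsub>(\<alpha>\<^bsub>Z(m)\<^esub>, 2k)\<^esub>\<close>, before passing to equivalence classes.\<close>

definition CG :: "nat \<Rightarrow> nat \<Rightarrow> vertex set set set" where
  "CG m k = {C. constraint_graph (verts (H_Z m k)) C \<and>
     (\<forall>P\<in>pieces m k. \<forall>u\<in>P. \<forall>v\<in>P. u \<noteq> v \<longrightarrow> (u, v) \<notin> conn (verts (H_Z m k)) C)}"

definition equivalent :: "nat \<Rightarrow> nat \<Rightarrow> vertex set set rel" where
  "equivalent m k = {(C, C'). C \<in> CG m k \<and> C' \<in> CG m k \<and>
     conn (verts (H_Z m k)) C = conn (verts (H_Z m k)) C'}"

definition dominant :: "nat \<Rightarrow> nat \<Rightarrow> vertex set set \<Rightarrow> bool" where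
  "dominant m k C \<longleftrightarrow> C \<in> CG m k \<and> val m k C \<noteq> 0 \<and>
     (\<forall>C'\<in>CG m k. val m k C' \<noteq> 0 \<longrightarrow> card C \<le> card C')"

text \<open>
  Equivalent constraint graphs are forests with the same components, so they have the same
  number of edges and the same value; the set of dominant constraint graphs is
  therefore a union of equivalence classes.
\<close>

definition dominant_classes :: "nat \<Rightarrow> nat \<Rightarrow> vertex set set set set" where
  "dominant_classes m k = {C. dominant m k C} // equivalent m k"

end

theory Submission
  imports Defs "HOL-Library.FuncSet"
begin

text \<open>
  A constraint graph is a forest, so its number of edges is the number of vertices minus the number
  of its classes (\<open>card_forest\<close>). Since every equivalence relation is the connectivity relation of
  some forest, the task is to count the equivalence relations on the vertices that separate the
  pieces, make all edge multiplicities even and have as many classes as possible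
  (\<open>card_dominant_classes\<close>).

  Read the vertices as a cyclic sequence of \<open>2k\<close> layers of \<open>m\<close> vertices, the \<open>a\<close>-layers and
  \<open>b\<close>-layers alternating, and let \<open>x t j\<close> be the class of vertex \<open>j\<close> of layer \<open>t\<close>. For each \<open>j\<close> the
  classes \<open>x t j\<close> form a closed walk of length \<open>2k\<close> in the quotient; the remaining edges connect
  walk \<open>j\<close> with walk \<open>j + 1\<close>.

  The maximum. Cut the cycle at some layer and go round once. If \<open>x t j\<close> occurred for the last time
  at \<open>t\<close> and \<open>x (t + 1) j\<close> for the first time at \<open>t + 1\<close>, then the edge between them would have
  multiplicity one. So each of the \<open>2km\<close> steps of the walks carries at most one of these two events.
  With \<open>N\<close> classes there are \<open>N - m\<close> events of each kind, because only the \<open>m\<close> classes of the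
  layer at the cut escape, and \<open>2 (N - m) \<le> 2km\<close> gives \<open>N \<le> m (k + 1)\<close> (\<open>card_labels_le\<close>).

  The case of equality. Now every step carries exactly one event, and this holds wherever the cycle
  is cut. Comparing two adjacent cuts shows that each step of a walk is retraced backwards at the
  moment when its starting class next recurs (\<open>turn_back\<close>). The steps of retracing between two
  consecutive layers form a perfect matching of the path formed by these layers; a path has only one
  perfect matching, so a step of a walk is retraced by a step of a walk (\<open>mirror\<close>). It follows by
  induction along the cycle that different walks, and the two kinds of layers, share no classes
  (\<open>label_determines_walk\<close>), and that each walk is the contour of a plane tree (\<open>noncrossing\<close>).
  Hence the classes of the \<open>a\<close>-vertices of walk \<open>j\<close> form a noncrossing partition \<open>P\<^sub>j\<close> of \<open>k\<close> points,
  those of the \<open>b\<close>-vertices form its Kreweras complement (\<open>complement\<close>), and a parity count over the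
  edges between walks \<open>j\<close> and \<open>j + 1\<close> shows that \<open>P\<^sub>j\<close> refines \<open>P\<^bsub>j+1\<^esub>\<close> (\<open>refinement\<close>). Conversely
  every multichain \<open>P\<^sub>1 \<le> \<dots> \<le> P\<^sub>m\<close> of noncrossing partitions arises in this way
  (\<open>partition_of_extremal\<close>).

  The count. In a multichain on an interval, the least elements of the blocks of the last point
  decrease with the level and cut the rest of the interval into \<open>m + 1\<close> parts that carry arbitrary
  multichains. Thus the generating function satisfies \<open>F = 1 + z F\<^bsup>m+1\<^esup>\<close>, and its coefficients are the
  Fuss-Catalan numbers (\<open>card_noncrossing_chains\<close>, \<open>fuss_catalan\<close>).
\<close>

section \<open>Raney numbers\<close>

text \<open>
  This is the coefficient of \<open>z\<^sup>n\<close> in \<open>F\<^sup>r\<close>, where \<open>F = 1 + z F\<^bsup>m+1\<^esup>\<close>; the last equation is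
  \<open>F\<^bsup>r+1\<^esup> = F\<^sup>r + z F\<^bsup>r+m+1\<^esup>\<close>.
\<close>

fun raney :: "nat \<Rightarrow> nat \<Rightarrow> nat \<Rightarrow> nat" where
  "raney m 0 r = 1"
| "raney m (Suc n) 0 = 0"
| "raney m (Suc n) (Suc r) = raney m (Suc n) r + raney m n (Suc (r + m))"

lemma raney_zero: "raney m n 0 = (if n = 0 then 1 else 0)"
  by (cases n) auto

text \<open>
  In terms of generating functions this is \<open>F\<^sup>a F\<^sup>b = F\<^bsup>a+b\<^esup>\<close>.
\<close>

lemma raney_convolution:
  "(\<Sum>i\<le>n. raney m i a * raney m (n - i) b) = raney m n (a + b)"
proof (induction n arbitrary: a b)
  case (Suc n)
  note outer = Suc.IH
  show ?case
  proof (induction a)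
    case 0
    have "(\<Sum>i\<le>Suc n. raney m i 0 * raney m (Suc n - i) b) = raney m (Suc n) b"
      by (subst sum.remove[of _ 0]) (auto simp: raney_zero)
    then show ?case by simp
  next
    case (Suc a)
    have "(\<Sum>i\<le>Suc n. raney m i (Suc a) * raney m (Suc n - i) b) =
      raney m (Suc n) b + (\<Sum>i\<le>n. (raney m (Suc i) a + raney m i (Suc (a + m))) * raney m (n - i) b)"
      by (subst sum.atMost_Suc_shift) simp
    also have "\<dots> = (raney m (Suc n) b + (\<Sum>i\<le>n. raney m (Suc i) a * raney m (n - i) b)) +
      (\<Sum>i\<le>n. raney m i (Suc (a + m)) * raney m (n - i) b)"
      by (simp add: sum.distrib distrib_right)
    also have "raney m (Suc n) b + (\<Sum>i\<le>n. raney m (Suc i) a * raney m (n - i) b) =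
      (\<Sum>i\<le>Suc n. raney m i a * raney m (Suc n - i) b)"
      by (subst sum.atMost_Suc_shift) simp
    also have "\<dots> = raney m (Suc n) (a + b)" by (rule Suc.IH)
    also have "(\<Sum>i\<le>n. raney m i (Suc (a + m)) * raney m (n - i) b) = raney m n (Suc (a + m) + b)"
      by (rule outer)
    finally show ?case by (simp add: add.commute add.left_commute)
  qed
qed simp

text \<open>
  Written as a difference of two binomial coefficients, the closed form satisfies the recursion by
  Pascal's rule alone; the boundary value at \<open>r = 0\<close> is the absorption identity.
\<close>

lemma raney_binomial:
  "raney m (Suc n) r + m * (((m + 1) * n + m + r) choose n) = ((m + 1) * n + m + r) choose Suc n"
proof (induction n arbitrary: r)
  case 0
  show ?case by (induction r) auto
next
  case (Suc n)
  note outer = Suc.IH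
  show ?case
  proof (induction r)
    case 0
    define M where "M = (m + 1) * Suc n + m"
    have "Suc (Suc n) * (M choose Suc (Suc n)) = (M choose Suc n) * (M - Suc n)"
      using binomial_absorb_comp[of M "Suc n"] binomial_absorption[of "Suc n" M]
      by (simp add: M_def mult.commute times_binomial_minus1_eq) 
    also have "M - Suc n = m * Suc (Suc n)" by (simp add: M_def algebra_simps)
    finally have "Suc (Suc n) * (M choose Suc (Suc n)) = Suc (Suc n) * (m * (M choose Suc n))"
      by (simp only: ac_simps)
    then have "M choose Suc (Suc n) = m * (M choose Suc n)" by (simp only: mult_cancel1) simp
    then show ?case by (simp add: M_def)
  next
    case (Suc r)
    define M where "M = (m + 1) * Suc n + m + r"
    have "(m + 1) * n + m + Suc (r + m) = M" by (simp add: M_def algebra_simps)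
    then have "raney m (Suc n) (Suc (r + m)) + m * (M choose n) = M choose Suc n"
      using outer[of "Suc (r + m)"] by simp
    moreover have "raney m (Suc (Suc n)) r + m * (M choose Suc n) = M choose Suc (Suc n)"
      using Suc.IH by (simp add: M_def)
    moreover have "(m + 1) * Suc n + m + Suc r = Suc M" by (simp add: M_def)
    ultimately show ?case by (simp add: algebra_simps)
  qed
qed

lemma fuss_catalan:
  "real (raney m k 1) = 1 / (real m * real k + 1) * real (((m + 1) * k) choose k)"
proof (cases k)
  case (Suc n)
  define M where "M = (m + 1) * k"
  have M: "(m + 1) * n + m + 1 = M" by (simp add: M_def Suc)
  have "raney m k 1 + m * (M choose n) = M choose k"
    using raney_binomial[of m n 1] by (simp only: M Suc)
  then have r: "real (raney m k 1) = real (M choose k) - real m * real (M choose n)"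
    by (metis add_diff_cancel_right' of_nat_add of_nat_mult)
  have "k * (M choose k) = (M choose n) * (M - n)"
    using binomial_absorb_comp[of M n] binomial_absorption[of n M]
    by (simp add: Suc mult.commute times_binomial_minus1_eq)
  also have "M - n = m * k + 1" by (simp add: M_def Suc)
  finally have "real k * real (M choose k) = real (M choose n) * (real m * real k + 1)"
    by (metis of_nat_1 of_nat_add of_nat_mult)
  then have "real m * (real k * real (M choose k)) = real m * (real (M choose n) * (real m * real k + 1))"
    by simp
  then have "(real m * real k + 1) * real (raney m k 1) = real (M choose k)"
    unfolding r by (simp add: algebra_simps)
  moreover have "real m * real k + 1 > 0" by (simp add: add_nonneg_pos)
  ultimately show ?thesis unfolding M_def by (simp add: field_simps)
qed simp

section \<open>Multichains of noncrossing partitions\<close>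

text \<open>
  A multichain of \<open>m\<close> noncrossing partitions of the points \<open>l, \<dots>, u - 1\<close>, the finest one at level 1.
  A partition is given by the function that sends each point to the least element of its block. For
  such a function, being noncrossing means that no block reaches below \<open>b i y\<close> from a point between
  \<open>b i y\<close> and \<open>y\<close>. The last condition says, for \<open>i' = i\<close>, that least elements are fixed points, and for
  \<open>i < i'\<close> that level \<open>i\<close> refines level \<open>i'\<close>. The value 0 outside the range makes the representation
  unique.
\<close>

definition noncrossing_chains :: "nat \<Rightarrow> nat \<Rightarrow> nat \<Rightarrow> (nat \<Rightarrow> nat \<Rightarrow> nat) set" where
  "noncrossing_chains m l u = {b. (\<forall>i y. i \<notin> {1..m} \<or> y \<notin> {l..<u} \<longrightarrow> b i y = 0) \<and>
     (\<forall>i\<in>{1..m}. \<forall>y\<in>{l..<u}. l \<le> b i y \<and> b i y \<le> y \<and> (\<forall>z\<in>{b i y..y}. b i y \<le> b i z) \<and>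
       (\<forall>i'\<in>{i..m}. b i' (b i y) = b i' y))}"

lemma noncrossing_chainsI:
  assumes "\<And>i y. i \<notin> {1..m} \<or> y \<notin> {l..<u} \<Longrightarrow> b i y = 0"
    and "\<And>i y. i \<in> {1..m} \<Longrightarrow> y \<in> {l..<u} \<Longrightarrow> l \<le> b i y \<and> b i y \<le> y"
    and "\<And>i y z. i \<in> {1..m} \<Longrightarrow> y \<in> {l..<u} \<Longrightarrow> b i y \<le> z \<Longrightarrow> z \<le> y \<Longrightarrow> b i y \<le> b i z"
    and "\<And>i i' y. i \<in> {1..m} \<Longrightarrow> y \<in> {l..<u} \<Longrightarrow> i' \<in> {i..m} \<Longrightarrow> b i' (b i y) = b i' y"
  shows "b \<in> noncrossing_chains m l u"
  unfolding noncrossing_chains_def using assms by simp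

lemma noncrossing_chainsD:
  assumes "b \<in> noncrossing_chains m l u"
  shows "i \<notin> {1..m} \<or> y \<notin> {l..<u} \<Longrightarrow> b i y = 0"
    and "i \<in> {1..m} \<Longrightarrow> y \<in> {l..<u} \<Longrightarrow> l \<le> b i y \<and> b i y \<le> y"
    and "i \<in> {1..m} \<Longrightarrow> y \<in> {l..<u} \<Longrightarrow> b i y \<le> z \<Longrightarrow> z \<le> y \<Longrightarrow> b i y \<le> b i z"
    and "i \<in> {1..m} \<Longrightarrow> y \<in> {l..<u} \<Longrightarrow> i' \<in> {i..m} \<Longrightarrow> b i' (b i y) = b i' y"
  using assms unfolding noncrossing_chains_def by simp_all

lemma finite_noncrossing_chains: "finite (noncrossing_chains m l u)"
proof -
  define B :: "(nat \<Rightarrow> nat) set" where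
    "B = {g. \<forall>y. (y \<in> {l..<u} \<longrightarrow> g y \<in> {0..u}) \<and> (y \<notin> {l..<u} \<longrightarrow> g y = 0)}"
  have "finite B" unfolding B_def by (rule finite_set_of_finite_funs) auto
  then have "finite {b. \<forall>i. (i \<in> {1..m} \<longrightarrow> b i \<in> B) \<and> (i \<notin> {1..m} \<longrightarrow> b i = (\<lambda>_. 0))}"
    by (intro finite_set_of_finite_funs) auto
  moreover have "noncrossing_chains m l u \<subseteq> {b. \<forall>i. (i \<in> {1..m} \<longrightarrow> b i \<in> B) \<and> (i \<notin> {1..m} \<longrightarrow> b i = (\<lambda>_. 0))}"
  proof (intro subsetI CollectI allI conjI impI)
    fix b i assume b: "b \<in> noncrossing_chains m l u"
    show "b i \<in> B" if "i \<in> {1..m}"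
      unfolding B_def using noncrossing_chainsD(1,2)[OF b] that by (fastforce simp: less_imp_le)
    show "b i = (\<lambda>_. 0)" if "i \<notin> {1..m}"
      using noncrossing_chainsD(1)[OF b] that by auto
  qed
  ultimately show ?thesis by (rule rev_finite_subset)
qed

text \<open>
  Multichains on the points \<open>l, \<dots>, u\<close> whose last point lies in the block of the first one at all
  levels from \<open>j\<close> on. For \<open>j = m + 1\<close> there is no restriction, while for \<open>j = 1\<close> the last point carries
  no information. Going from one to the other cuts the interval \<open>m\<close> times.
\<close>

definition anchored_chains :: "nat \<Rightarrow> nat \<Rightarrow> nat \<Rightarrow> nat \<Rightarrow> (nat \<Rightarrow> nat \<Rightarrow> nat) set" where
  "anchored_chains m j l u = {b \<in> noncrossing_chains m l (Suc u). \<forall>i\<in>{j..m}. b i u = l}"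

lemma card_anchored_one:
  assumes "l \<le> u"
  shows "card (anchored_chains m 1 l u) = card (noncrossing_chains m l u)"
proof -
  define extend where "extend = (\<lambda>(b :: nat \<Rightarrow> nat \<Rightarrow> nat) i y. if i \<in> {1..m} \<and> y = u then l else b i y)"
  define res where "res = (\<lambda>(b :: nat \<Rightarrow> nat \<Rightarrow> nat) i y. if y = u then 0 else b i y)"
  have "bij_betw extend (noncrossing_chains m l u) (anchored_chains m 1 l u)"
  proof (rule bij_betwI[of _ _ _ res])
    show "extend \<in> noncrossing_chains m l u \<rightarrow> anchored_chains m 1 l u"
    proof
      fix b assume "b \<in> noncrossing_chains m l u"
      note b = noncrossing_chainsD[OF this]
      have low: "b i l = l" if "i \<in> {1..m}" "l < u" for i using b(2)[of i l] that by simp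
      have "extend b \<in> noncrossing_chains m l (Suc u)"
      proof (rule noncrossing_chainsI)
        show "extend b i y = 0" if "i \<notin> {1..m} \<or> y \<notin> {l..<Suc u}" for i y
          using that b(1)[of i y] assms by (auto simp: extend_def)
        show bd: "l \<le> extend b i y \<and> extend b i y \<le> y" if "i \<in> {1..m}" "y \<in> {l..<Suc u}" for i y
          using that b(2)[of i y] assms by (auto simp: extend_def)
        show "extend b i y \<le> extend b i z" if "i \<in> {1..m}" "y \<in> {l..<Suc u}" "extend b i y \<le> z" "z \<le> y" for i y z
        proof (cases "y = u")
          case True
          then show ?thesis using bd[of i z] that by (simp add: extend_def)
        next
          case False
          then show ?thesis using b(3)[of i y z] that by (simp add: extend_def)
        qed
        show "extend b i' (extend b i y) = extend b i' y" if "i \<in> {1..m}" "y \<in> {l..<Suc u}" "i' \<in> {i..m}" for i i' y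
        proof (cases "y = u")
          case True
          then show ?thesis using that low[of i'] assms by (cases "l = u") (auto simp: extend_def)
        next
          case False
          then show ?thesis using b(4)[of i y i'] b(2)[of i y] that by (simp add: extend_def)
        qed
      qed
      then show "extend b \<in> anchored_chains m 1 l u" by (simp add: anchored_chains_def extend_def)
    qed
    show "res \<in> anchored_chains m 1 l u \<rightarrow> noncrossing_chains m l u"
    proof
      fix b assume "b \<in> anchored_chains m 1 l u"
      then have "b \<in> noncrossing_chains m l (Suc u)" by (simp add: anchored_chains_def)
      note b = noncrossing_chainsD[OF this]
      show "res b \<in> noncrossing_chains m l u"
      proof (rule noncrossing_chainsI)
        show "res b i y = 0" if "i \<notin> {1..m} \<or> y \<notin> {l..<u}" for i y
          using that b(1)[of i y] by (auto simp: res_def)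
        show "l \<le> res b i y \<and> res b i y \<le> y" if "i \<in> {1..m}" "y \<in> {l..<u}" for i y
          using that b(2)[of i y] by (auto simp: res_def)
        show "res b i y \<le> res b i z" if "i \<in> {1..m}" "y \<in> {l..<u}" "res b i y \<le> z" "z \<le> y" for i y z
          using that b(3)[of i y z] by (auto simp: res_def)
        show "res b i' (res b i y) = res b i' y" if "i \<in> {1..m}" "y \<in> {l..<u}" "i' \<in> {i..m}" for i i' y
          using that b(4)[of i y i'] b(2)[of i y] by (auto simp: res_def)
      qed
    qed
    show "res (extend b) = b" if "b \<in> noncrossing_chains m l u" for b
      using noncrossing_chainsD(1)[OF that] by (force simp: res_def extend_def)
    show "extend (res b) = b" if "b \<in> anchored_chains m 1 l u" for b
    proof (intro ext)
      fix i y
      have b: "b \<in> noncrossing_chains m l (Suc u)" "\<forall>i\<in>{1..m}. b i u = l"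
        using that by (auto simp: anchored_chains_def)
      show "extend (res b) i y = b i y"
        using noncrossing_chainsD(1)[OF b(1), of i y] b(2) by (auto simp: res_def extend_def)
    qed
  qed
  then show ?thesis by (simp add: bij_betw_same_card)
qed

text \<open>
  Let \<open>c\<close> be the least element of the block of \<open>u\<close> at level \<open>j\<close>. Below \<open>c\<close> the multichain is arbitrary;
  from \<open>c\<close> on it is anchored at \<open>c\<close> from level \<open>j\<close> on. At the levels up to \<open>j\<close> no block meets both
  parts, and at the later levels only the block of \<open>l\<close> does, which is then the union of the block of
  \<open>l\<close> on the left and of the block of \<open>c\<close> on the right. So the two parts determine the multichain.
\<close>

lemma card_anchored_Suc:
  assumes lu: "l \<le> u" and j: "1 \<le> j" "j \<le> m"
  shows "card (anchored_chains m (Suc j) l u) =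
    (\<Sum>c\<in>{l..u}. card (noncrossing_chains m l c) * card (anchored_chains m j c u))"
proof -
  define glue :: "nat \<times> (nat \<Rightarrow> nat \<Rightarrow> nat) \<times> (nat \<Rightarrow> nat \<Rightarrow> nat) \<Rightarrow> nat \<Rightarrow> nat \<Rightarrow> nat" where
    "glue = (\<lambda>(c, b1, b2) i y. if y < c then b1 i y
      else if i \<in> {Suc j..m} \<and> y \<le> u \<and> b2 i y = c then l else b2 i y)"
  define left :: "nat \<Rightarrow> (nat \<Rightarrow> nat \<Rightarrow> nat) \<Rightarrow> nat \<Rightarrow> nat \<Rightarrow> nat" where
    "left = (\<lambda>c b i y. if y < c then b i y else 0)"
  \<comment> \<open>Replacing least elements below the cut by the cut itself restricts a partition to \<open>{c..u}\<close>.\<close>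
  define right :: "nat \<Rightarrow> (nat \<Rightarrow> nat \<Rightarrow> nat) \<Rightarrow> nat \<Rightarrow> nat \<Rightarrow> nat" where
    "right = (\<lambda>c b i y. if i \<in> {1..m} \<and> y \<in> {c..u} then max c (b i y) else 0)"
  define cut_at :: "(nat \<Rightarrow> nat \<Rightarrow> nat) \<Rightarrow> nat \<times> (nat \<Rightarrow> nat \<Rightarrow> nat) \<times> (nat \<Rightarrow> nat \<Rightarrow> nat)" where
    "cut_at = (\<lambda>b. (b j u, left (b j u) b, right (b j u) b))"
  let ?S = "Sigma {l..u} (\<lambda>c. noncrossing_chains m l c \<times> anchored_chains m j c u)"
  have "bij_betw glue ?S (anchored_chains m (Suc j) l u)"
  proof (rule bij_betwI[of _ _ _ cut_at])
    show "glue \<in> ?S \<rightarrow> anchored_chains m (Suc j) l u"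
    proof (rule funcsetI, clarify)
      fix c b1 b2 assume c: "c \<in> {l..u}" and b1': "b1 \<in> noncrossing_chains m l c"
        and b2': "b2 \<in> anchored_chains m j c u"
      then have b2'': "b2 \<in> noncrossing_chains m c (Suc u)" "\<And>i. i \<in> {j..m} \<Longrightarrow> b2 i u = c"
        by (auto simp: anchored_chains_def)
      note b1 = noncrossing_chainsD[OF b1'] and b2 = noncrossing_chainsD[OF b2''(1)]
      define b where "b = glue (c, b1, b2)"
      have b_left: "b i y = b1 i y" if "y < c" for i y using that by (simp add: b_def glue_def)
      have b_low: "b i y = l" if "y \<ge> c" "i \<in> {Suc j..m}" "y \<le> u" "b2 i y = c" for i y
        using that by (simp add: b_def glue_def)
      have b_right: "b i y = b2 i y" if "y \<ge> c" "\<not> (i \<in> {Suc j..m} \<and> y \<le> u \<and> b2 i y = c)" for i y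
        using that by (auto simp: b_def glue_def)
      have b_cases: "(i \<in> {Suc j..m} \<and> b2 i y = c \<and> b i y = l) \<or>
          (\<not> (i \<in> {Suc j..m} \<and> y \<le> u \<and> b2 i y = c) \<and> b i y = b2 i y)" if "y \<ge> c" for i y
        using b_low[of y i] b_right[of y i] that by blast
      have bd: "l \<le> b i y \<and> b i y \<le> y" if "i \<in> {1..m}" "y \<in> {l..<Suc u}" for i y
      proof (cases "y < c")
        case True then show ?thesis using b1(2)[of i y] that b_left by simp
      next
        case False
        then show ?thesis using b_cases[of y i] b2(2)[of i y] that c by auto
      qed
      have low: "b i l = l" if "i \<in> {1..m}" for i using bd[of i l] that lu by simp
      have "b \<in> noncrossing_chains m l (Suc u)"
      proof (rule noncrossing_chainsI)
        show "b i y = 0" if "i \<notin> {1..m} \<or> y \<notin> {l..<Suc u}" for i y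
          using that b1(1)[of i y] b2(1)[of i y] c by (auto simp: b_def glue_def)
        show "l \<le> b i y \<and> b i y \<le> y" if "i \<in> {1..m}" "y \<in> {l..<Suc u}" for i y
          using bd that .
        show "b i y \<le> b i z" if *: "i \<in> {1..m}" "y \<in> {l..<Suc u}" "b i y \<le> z" "z \<le> y" for i y z
        proof (cases "y < c")
          case True then show ?thesis using b1(3)[of i y z] * b_left by simp
        next
          case False
          have lz: "l \<le> b i z" using bd[of i z] bd[of i y] * by auto
          from b_cases[of y i] False consider "b i y = l"
            | "b i y = b2 i y" "\<not> (i \<in> {Suc j..m} \<and> y \<le> u \<and> b2 i y = c)" by fastforce
          then show ?thesis
          proof cases
            case 1 then show ?thesis using lz by simp
          next
            case 2
            have "c \<le> b2 i y" using b2(2)[of i y] * False by simp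
            then have "c \<le> z" "b2 i y \<le> b2 i z" using b2(3)[of i y z] * 2 False by auto
            then show ?thesis using b_cases[of z i] 2 \<open>c \<le> b2 i y\<close> * by auto
          qed
        qed
        show "b i' (b i y) = b i' y" if *: "i \<in> {1..m}" "y \<in> {l..<Suc u}" "i' \<in> {i..m}" for i i' y
        proof (cases "y < c")
          case True
          then have "b1 i y < c" using b1(2)[of i y] * by fastforce
          then show ?thesis using b1(4)[of i y i'] * b_left True by simp
        next
          case False
          have comp: "b2 i' (b2 i y) = b2 i' y" using b2(4)[of i y i'] * False by simp
          have bds: "c \<le> b2 i y" "b2 i y \<le> y" using b2(2)[of i y] * False by auto
          from b_cases[of y i] False consider "i \<in> {Suc j..m}" "b2 i y = c" "b i y = l"
            | "b i y = b2 i y" by fastforce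
          then show ?thesis
          proof cases
            case 1
            have "b2 i' c = c" using b2(2)[of i' c] * c by simp
            then have "b2 i' y = c" using comp 1 by simp
            then have "b i' y = l" using b_low[of y i'] 1 * False by simp
            then show ?thesis using 1 low[of i'] * by simp
          next
            case 2
            have "b i' (b2 i y) = b i' y"
              using comp bds False * by (auto simp: b_def glue_def)
            then show ?thesis using 2 by simp
          qed
        qed
      qed
      moreover have "b i u = l" if "i \<in> {Suc j..m}" for i
        using that b_low[of u i] b2''(2)[of i] c by simp
      ultimately show "glue (c, b1, b2) \<in> anchored_chains m (Suc j) l u"
        by (simp add: anchored_chains_def b_def)
    qed
  next
    have main: "b j u \<in> {l..u} \<and> left (b j u) b \<in> noncrossing_chains m l (b j u) \<and>
      right (b j u) b \<in> anchored_chains m j (b j u) u \<and> glue (cut_at b) = b"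
      if b': "b \<in> anchored_chains m (Suc j) l u" for b
    proof -
      define c where "c = b j u"
      from b' have b'': "b \<in> noncrossing_chains m l (Suc u)" "\<And>i. i \<in> {Suc j..m} \<Longrightarrow> b i u = l"
        by (auto simp: anchored_chains_def)
      note b = noncrossing_chainsD[OF b''(1)]
      have c: "l \<le> c" "c \<le> u" using b(2)[of j u] j lu by (auto simp: c_def)
      \<comment> \<open>No block of a level up to \<open>j\<close> straddles the cut.\<close>
      have fine: "c \<le> b i y" if "1 \<le> i" "i \<le> j" "c \<le> y" "y \<le> u" for i y
      proof -
        have "c \<le> b j y" using b(3)[of j u y] that j lu by (simp add: c_def)
        moreover have "b j (b i y) = b j y" using b(4)[of i y j] that j c by simp
        moreover have "l \<le> b i y \<and> b i y \<le> y" using b(2)[of i y] that j c by simp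
        then have "b j (b i y) \<le> b i y" using b(2)[of j "b i y"] that j by simp
        ultimately show ?thesis by simp
      qed
      have low: "b i c = l" if "i \<in> {Suc j..m}" for i
        using b(4)[of j u i] b''(2)[of i] that j lu by (simp add: c_def)
      \<comment> \<open>At the levels above \<open>j\<close>, a block that straddles the cut is the block of \<open>l\<close>.\<close>
      have coarse: "b i y = l" if "i \<in> {Suc j..m}" "c \<le> y" "y \<le> u" "b i y \<le> c" for i y
      proof -
        have i: "i \<in> {1..m}" using that j by auto
        have "b i y \<le> b i c" using b(3)[of i y c] i that c by simp
        then show ?thesis using low[OF that(1)] b(2)[of i y] i that c by simp
      qed
      have left: "left c b \<in> noncrossing_chains m l c"
      proof (rule noncrossing_chainsI)
        show "left c b i y = 0" if "i \<notin> {1..m} \<or> y \<notin> {l..<c}" for i y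
          using that b(1)[of i y] by (auto simp: left_def)
        show bd: "l \<le> left c b i y \<and> left c b i y \<le> y" if "i \<in> {1..m}" "y \<in> {l..<c}" for i y
          using that b(2)[of i y] c by (auto simp: left_def)
        show "left c b i y \<le> left c b i z"
          if "i \<in> {1..m}" "y \<in> {l..<c}" "left c b i y \<le> z" "z \<le> y" for i y z
          using that b(3)[of i y z] c by (auto simp: left_def)
        show "left c b i' (left c b i y) = left c b i' y" if "i \<in> {1..m}" "y \<in> {l..<c}" "i' \<in> {i..m}" for i i' y
          using that b(4)[of i y i'] b(2)[of i y] c by (auto simp: left_def)
      qed
      have right: "right c b \<in> noncrossing_chains m c (Suc u)"
      proof (rule noncrossing_chainsI)
        show "right c b i y = 0" if "i \<notin> {1..m} \<or> y \<notin> {c..<Suc u}" for i y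
          using that by (auto simp: right_def)
        show bd: "c \<le> right c b i y \<and> right c b i y \<le> y" if "i \<in> {1..m}" "y \<in> {c..<Suc u}" for i y
          using that b(2)[of i y] c by (auto simp: right_def)
        show "right c b i y \<le> right c b i z"
          if *: "i \<in> {1..m}" "y \<in> {c..<Suc u}" "right c b i y \<le> z" "z \<le> y" for i y z
        proof -
          have "c \<le> z" using bd[of i y] * by simp
          then show ?thesis using * b(3)[of i y z] c by (auto simp: right_def max_def)
        qed
        show "right c b i' (right c b i y) = right c b i' y"
          if *: "i \<in> {1..m}" "y \<in> {c..<Suc u}" "i' \<in> {i..m}" for i i' y
        proof (cases "c \<le> b i y")
          case True
          then show ?thesis using * b(4)[of i y i'] b(2)[of i y] c by (simp add: right_def max_def)
        next
          case False
          then have i: "i \<in> {Suc j..m}" using fine[of i y] * by fastforce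
          then have i': "i' \<in> {Suc j..m}" "i' \<in> {1..m}" using * by auto
          have comp: "b i' (b i y) = b i' y" using b(4)[of i y i'] * c by simp
          have "l \<le> b i y" "b i y \<le> y" using b(2)[of i y] * c by auto
          then have "b i' (b i y) \<le> b i y" using b(2)[of i' "b i y"] i' * by simp
          then have "b i' y \<le> c" using comp False by simp
          then show ?thesis using * low[OF i'(1)] i' False c by (simp add: right_def max_def)
        qed
      qed
      have "right c b i u = c" if "i \<in> {j..m}" for i
      proof (cases "i = j")
        case True
        then show ?thesis using j c by (simp add: right_def c_def)
      next
        case False
        then show ?thesis using b''(2)[of i] that j c by (simp add: right_def)
      qed
      then have right': "right c b \<in> anchored_chains m j c u"
        using right by (simp add: anchored_chains_def)
      have "glue (c, left c b, right c b) i y = b i y" for i y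
      proof (cases "i \<in> {1..m} \<and> y \<in> {l..u}")
        case False
        then show ?thesis using b(1)[of i y] c j by (auto simp: glue_def left_def right_def)
      next
        case True
        then have bl: "l \<le> b i y" using b(2)[of i y] by simp
        show ?thesis
        proof (cases "y < c")
          case True then show ?thesis by (simp add: glue_def left_def)
        next
          case y: False
          show ?thesis
          proof (cases "i \<le> j")
            case i: True
            then have "c \<le> b i y" using fine[of i y] True y by simp
            then show ?thesis using True y i by (simp add: glue_def right_def)
          next
            case i: False
            show ?thesis
            proof (cases "b i y \<le> c")
              case le: True
              then have "b i y = l" using coarse[of i y] True y i by simp
              then show ?thesis using True y i le by (simp add: glue_def right_def max_def)
            next
              case False
              then show ?thesis using True y i by (simp add: glue_def right_def max_def)
            qed
          qed
        qed
      qed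
      then have "glue (cut_at b) = b" by (intro HOL.ext) (simp add: cut_at_def c_def)
      then show ?thesis using c left right' by (simp add: c_def)
    qed
    show "cut_at \<in> anchored_chains m (Suc j) l u \<rightarrow> ?S"
      using main by (auto simp: cut_at_def)
    show "glue (cut_at b) = b" if "b \<in> anchored_chains m (Suc j) l u" for b
      using main that by blast
    show "cut_at (glue p) = p" if "p \<in> ?S" for p
    proof -
      obtain c b1 b2 where p: "p = (c, b1, b2)" by (cases p) auto
      with that have c: "c \<in> {l..u}" and b1': "b1 \<in> noncrossing_chains m l c"
        and b2': "b2 \<in> noncrossing_chains m c (Suc u)" "\<And>i. i \<in> {j..m} \<Longrightarrow> b2 i u = c"
        by (auto simp: anchored_chains_def)
      note b1 = noncrossing_chainsD[OF b1'] and b2 = noncrossing_chainsD[OF b2'(1)]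
      have c_eq: "glue p j u = c" using b2'(2)[of j] c j by (simp add: glue_def p)
      moreover have "left c (glue p) i y = b1 i y" for i y
        using b1(1)[of i y] by (auto simp: left_def glue_def p)
      then have "left c (glue p) = b1" by (intro HOL.ext)
      moreover have "right c (glue p) i y = b2 i y" for i y
        using b2(1)[of i y] b2(2)[of i y] c by (auto simp: right_def glue_def p)
      then have "right c (glue p) = b2" by (intro HOL.ext)
      ultimately show ?thesis by (simp add: cut_at_def p)
    qed
  qed
  then have "card (anchored_chains m (Suc j) l u) = card ?S" by (simp add: bij_betw_same_card)
  also have "\<dots> = (\<Sum>c\<in>{l..u}. card (noncrossing_chains m l c \<times> anchored_chains m j c u))"
    by (rule card_SigmaI) (auto intro!: finite_cartesian_product finite_noncrossing_chains
        simp: anchored_chains_def)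
  finally show ?thesis by (simp add: card_cartesian_product)
qed

text \<open>
  A multichain on \<open>n + 1\<close> points is an anchored one with no restriction, and \<open>m\<close> cuts reduce it to
  \<open>m + 1\<close> independent multichains on \<open>n\<close> points in total.
\<close>

theorem card_noncrossing_chains:
  "l \<le> u \<Longrightarrow> card (noncrossing_chains m l u) = raney m (u - l) 1"
proof (induction "u - l" arbitrary: l u rule: less_induct)
  case less
  show ?case
  proof (cases "l = u")
    case True
    have "noncrossing_chains m u u = {\<lambda>i y. 0}" by (auto simp: noncrossing_chains_def)
    then show ?thesis using True by simp
  next
    case False
    then obtain v where v: "u = Suc v" "l \<le> v" using less.prems by (cases u) auto
    have chains: "card (noncrossing_chains m c d) = raney m (d - c) 1" if "l \<le> c" "c \<le> d" "d \<le> v" for c d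
      using less.hyps[of d c] that v by simp
    have "card (anchored_chains m j c v) = raney m (v - c) j" if "1 \<le> j" "j \<le> Suc m" "l \<le> c" "c \<le> v" for j c
      using that
    proof (induction j arbitrary: c rule: dec_induct)
      case base
      then show ?case using card_anchored_one chains by simp
    next
      case (step j)
      have "card (anchored_chains m (Suc j) c v) =
        (\<Sum>d\<in>{c..v}. card (noncrossing_chains m c d) * card (anchored_chains m j d v))"
        using step by (intro card_anchored_Suc) auto
      also have "\<dots> = (\<Sum>d\<in>{c..v}. raney m (d - c) 1 * raney m (v - d) j)"
        using step chains by (intro sum.cong) auto
      also have "\<dots> = (\<Sum>i\<le>v - c. raney m i 1 * raney m (v - c - i) j)"
        using step.prems
        by (intro sum.reindex_bij_witness[of _ "\<lambda>i. i + c" "\<lambda>d. d - c"]) auto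
      also have "\<dots> = raney m (v - c) (Suc j)" unfolding raney_convolution by simp
      finally show ?case .
    qed
    then have "card (anchored_chains m (Suc m) l v) = raney m (v - l) (Suc m)" using v by simp
    moreover have "anchored_chains m (Suc m) l v = noncrossing_chains m l u"
      by (simp add: anchored_chains_def v)
    moreover have "u - l = Suc (v - l)" using v by simp
    ultimately show ?thesis by simp
  qed
qed

section \<open>Labellings of a cyclic sequence of layers\<close>

text \<open>
  Vertex \<open>p\<close> of layer \<open>t\<close> and vertex \<open>q\<close> of layer \<open>t + 1\<close> are joined by an edge. The even layers are the
  \<open>a\<close>-layers; between two consecutive layers the edges form a path.
\<close>

definition adj :: "nat \<Rightarrow> nat \<Rightarrow> nat \<Rightarrow> bool" where
  "adj t p q \<longleftrightarrow> p = q \<or> (if even t then p = Suc q else q = Suc p)"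

text \<open>
  The pairs of points of one block of \<open>f\<close> that are separated by the gap between \<open>i\<close> and \<open>i + 1\<close>. If \<open>f\<close>
  labels the blocks of a noncrossing partition, the gaps with equal cuts form the blocks of its
  Kreweras complement.
\<close>

definition cut :: "nat \<Rightarrow> (nat \<Rightarrow> 'a) \<Rightarrow> nat \<Rightarrow> (nat \<times> nat) set" where
  "cut k f i = {(s, u). s \<le> i \<and> i < u \<and> u < k \<and> f s = f u}"

text \<open>
  Two gaps separate the same pairs if and only if the interval between them is a union of blocks.
\<close>

lemma cut_eq_iff:
  assumes "i \<le> i'" "i' < k"
  shows "cut k f i = cut k f i' \<longleftrightarrow>
    (\<forall>s\<in>{i<..i'}. \<forall>u<k. f u = f s \<longrightarrow> u \<in> {i<..i'})"
proof
  assume eq: "cut k f i = cut k f i'"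
  show "\<forall>s\<in>{i<..i'}. \<forall>u<k. f u = f s \<longrightarrow> u \<in> {i<..i'}"
  proof (intro ballI allI impI, rule ccontr)
    fix s u assume *: "s \<in> {i<..i'}" "u < k" "f u = f s" "u \<notin> {i<..i'}"
    then consider "u \<le> i" | "u > i'" by force
    then show False
    proof cases
      case 1
      then have "(u, s) \<in> cut k f i" "(u, s) \<notin> cut k f i'" using * assms by (auto simp: cut_def)
      then show False using eq by simp
    next
      case 2
      then have "(s, u) \<in> cut k f i'" "(s, u) \<notin> cut k f i" using * assms by (auto simp: cut_def)
      then show False using eq by simp
    qed
  qed
next
  assume *: "\<forall>s\<in>{i<..i'}. \<forall>u<k. f u = f s \<longrightarrow> u \<in> {i<..i'}"
  have "s \<le> i \<and> i < u \<longleftrightarrow> s \<le> i' \<and> i' < u" if "u < k" "f s = f u" for s u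
  proof (cases "s < u")
    case True
    then show ?thesis
      using *[rule_format, of s u] *[rule_format, of u s] that assms by force
  qed auto
  then show "cut k f i = cut k f i'"
    unfolding cut_def by (intro Collect_cong) (auto split: prod.split)
qed

text \<open>
  Labels of \<open>2k\<close> cyclic layers with \<open>m\<close> vertices each; the time \<open>t\<close> runs through all natural numbers with
  period \<open>2k\<close>. The last assumption is how the evenness of the edge multiplicities enters: a step of a walk
  is never the only occurrence of its edge.
\<close>

locale layered_walks =
  fixes m k :: nat and x :: "nat \<Rightarrow> nat \<Rightarrow> 'b"
  assumes k_pos: "k \<ge> 1"
    and period: "x (t + 2 * k) j = x t j"
    and inj_layer: "\<lbrakk>j \<in> {1..m}; j' \<in> {1..m}; x t j = x t j'\<rbrakk> \<Longrightarrow> j = j'"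
    and adjacent_distinct: "\<lbrakk>j \<in> {1..m}; j' \<in> {1..m}\<rbrakk> \<Longrightarrow> x t j \<noteq> x (Suc t) j'"
    and repeated: "j \<in> {1..m} \<Longrightarrow> \<exists>t' p q. t' mod (2 * k) \<noteq> t mod (2 * k) \<and> p \<in> {1..m} \<and> q \<in> {1..m} \<and>
      adj t' p q \<and> {x t j, x (Suc t) j} = {x t' p, x (Suc t') q}"
begin

definition layer :: "nat \<Rightarrow> 'b set" where
  "layer t = x t ` {1..m}"

definition labels :: "'b set" where
  "labels = (\<Union>t. layer t)"

lemma period_mult: "x (t + n * (2 * k)) j = x t j"
proof (induction n)
  case (Suc n)
  have "x (t + Suc n * (2 * k)) j = x ((t + n * (2 * k)) + 2 * k) j"
    by (simp add: algebra_simps)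
  then show ?case using Suc period by simp
qed simp

lemma period_mod: "t mod (2 * k) = t' mod (2 * k) \<Longrightarrow> x t j = x t' j"
  by (metis mod_div_mult_eq period_mult)

lemma period_diff: "t \<ge> 2 * k \<Longrightarrow> x (t - 2 * k) j = x t j"
  using period[of "t - 2 * k" j] by simp

lemma layer_mod: "t mod (2 * k) = t' mod (2 * k) \<Longrightarrow> layer t = layer t'"
  unfolding layer_def by (intro image_cong refl period_mod)

lemma layer_period: "layer (t + 2 * k) = layer t"
  by (rule layer_mod) simp

lemma layer_diff: "t \<ge> 2 * k \<Longrightarrow> layer (t - 2 * k) = layer t"
  using layer_period[of "t - 2 * k"] by simp

lemma in_layer: "j \<in> {1..m} \<Longrightarrow> x t j \<in> layer t"
  by (simp add: layer_def)

lemma in_labels: "1 \<le> j \<Longrightarrow> j \<le> m \<Longrightarrow> x t j \<in> labels"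
  using in_layer[of j t] by (auto simp: labels_def)

lemma layer_disjoint: "layer t \<inter> layer (Suc t) = {}"
  using adjacent_distinct by (auto simp: layer_def)

lemma representative_in_window: "\<exists>t'\<in>{t0..<t0 + 2 * k}. t' mod (2 * k) = t mod (2 * k)"
proof -
  have pos: "2 * k > 0" using k_pos by simp
  define d where "d = (t + (2 * k - t0 mod (2 * k))) mod (2 * k)"
  have "(t0 + d) mod (2 * k) = (t0 mod (2 * k) + (t + (2 * k - t0 mod (2 * k)))) mod (2 * k)"
    unfolding d_def by (metis mod_add_left_eq mod_add_right_eq)
  also have "t0 mod (2 * k) + (t + (2 * k - t0 mod (2 * k))) = t + 2 * k"
    using mod_less_divisor[OF pos, of t0] by simp
  finally have "(t0 + d) mod (2 * k) = t mod (2 * k)" by simp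
  moreover have "d < 2 * k" using pos by (simp add: d_def)
  ultimately show ?thesis by (intro bexI[of _ "t0 + d"]) auto
qed

lemma labels_window: "labels = (\<Union>t\<in>{t0..t0 + 2 * k}. layer t)"
proof -
  have "layer t \<subseteq> (\<Union>t\<in>{t0..t0 + 2 * k}. layer t)" for t
  proof -
    obtain t' where "t' \<in> {t0..<t0 + 2 * k}" "t' mod (2 * k) = t mod (2 * k)"
      using representative_in_window by blast
    then show ?thesis using layer_mod[of t' t] by force
  qed
  then show ?thesis unfolding labels_def by blast
qed

lemma parity_mod: "t mod (2 * k) = t' mod (2 * k) \<Longrightarrow> even t \<longleftrightarrow> even (t'::nat)"
  using dvd_mod_iff[of 2 "2 * k" t] dvd_mod_iff[of 2 "2 * k" t'] by simp

lemma repeated_in_window: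
  assumes "j \<in> {1..m}" "t \<in> {t0..<t0 + 2 * k}"
  obtains t' p q where "t' \<in> {t0..<t0 + 2 * k}" "t' \<noteq> t" "p \<in> {1..m}" "q \<in> {1..m}" "adj t' p q"
    "{x t j, x (Suc t) j} = {x t' p, x (Suc t') q}"
proof -
  obtain t1 p q where t1: "t1 mod (2 * k) \<noteq> t mod (2 * k)" "p \<in> {1..m}" "q \<in> {1..m}"
    "adj t1 p q" "{x t j, x (Suc t) j} = {x t1 p, x (Suc t1) q}"
    using repeated[OF assms(1), of t] by blast
  obtain t' where t': "t' \<in> {t0..<t0 + 2 * k}" "t' mod (2 * k) = t1 mod (2 * k)"
    using representative_in_window by blast
  have "Suc t' mod (2 * k) = Suc t1 mod (2 * k)" using t'(2) by (metis mod_Suc)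
  then have "x (Suc t') q = x (Suc t1) q" "x t' p = x t1 p"
    using period_mod[of "Suc t'" "Suc t1" q] period_mod[OF t'(2), of p] by blast+
  then have eq: "{x t j, x (Suc t) j} = {x t' p, x (Suc t') q}"
    using t1(5) by (simp only:)
  have ad: "adj t' p q" using t1(4) parity_mod[OF t'(2)] by (simp add: adj_def)
  have ne: "t' \<noteq> t" using t'(2) t1(1) by auto
  show ?thesis by (rule that[OF t'(1) ne t1(2,3) ad eq])
qed

text \<open>
  The window from \<open>t0\<close> to \<open>t0 + 2k\<close> goes round the cycle once and contains the initial layer twice, so
  that every step has both of its ends in the window.
\<close>

definition firsts :: "nat \<Rightarrow> (nat \<times> nat) set" where
  "firsts t0 = {(t, j). t \<in> {t0..t0 + 2 * k} \<and> j \<in> {1..m} \<and> (\<forall>r\<in>{t0..<t}. x t j \<notin> layer r)}"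

definition lasts :: "nat \<Rightarrow> (nat \<times> nat) set" where
  "lasts t0 = {(t, j). t \<in> {t0..t0 + 2 * k} \<and> j \<in> {1..m} \<and> (\<forall>r\<in>{t<..t0 + 2 * k}. x t j \<notin> layer r)}"

lemma card_one_per_label:
  assumes S: "\<And>t j. (t, j) \<in> S \<Longrightarrow> j \<in> {1..m}"
    and covers: "\<And>l. l \<in> labels \<Longrightarrow> \<exists>(t, j)\<in>S. x t j = l"
    and once: "\<And>t j t' j'. (t, j) \<in> S \<Longrightarrow> (t', j') \<in> S \<Longrightarrow> x t j = x t' j' \<Longrightarrow> \<not> t < t'"
  shows "card S = card labels"
proof -
  have "inj_on (\<lambda>(t, j). x t j) S"
  proof (rule inj_onI, clarify)
    fix t j t' j' assume *: "(t, j) \<in> S" "(t', j') \<in> S" "x t j = x t' j'"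
    then have "t = t'" using once[OF *(1,2)] once[OF *(2,1)] by (metis linorder_neqE_nat)
    then show "t = t' \<and> j = j'" using * S inj_layer by blast
  qed
  moreover have "(\<lambda>(t, j). x t j) ` S = labels"
  proof
    show "(\<lambda>(t, j). x t j) ` S \<subseteq> labels" using S in_labels by fastforce
    show "labels \<subseteq> (\<lambda>(t, j). x t j) ` S"
    proof
      fix l assume "l \<in> labels"
      then obtain t j where "(t, j) \<in> S" "x t j = l" using covers by blast
      then show "l \<in> (\<lambda>(t, j). x t j) ` S" by force
    qed
  qed
  ultimately show ?thesis using card_image by metis
qed

lemma card_firsts: "card (firsts t0) = card labels"
proof (rule card_one_per_label)
  show "j \<in> {1..m}" if "(t, j) \<in> firsts t0" for t j using that by (simp add: firsts_def)
  show "\<exists>(t, j)\<in>firsts t0. x t j = l" if l: "l \<in> labels" for l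
  proof -
    let ?P = "\<lambda>t. t \<in> {t0..t0 + 2 * k} \<and> l \<in> layer t"
    have ex: "\<exists>t. ?P t" using l labels_window[of t0] by auto
    define t where "t = (LEAST t. ?P t)"
    have t: "t \<in> {t0..t0 + 2 * k}" "l \<in> layer t" using LeastI_ex[OF ex] by (auto simp: t_def)
    have "l \<notin> layer r" if "r \<in> {t0..<t}" for r
      using not_less_Least[of r ?P] that t by (auto simp: t_def)
    moreover obtain j where "j \<in> {1..m}" "l = x t j" using t by (auto simp: layer_def)
    ultimately have "(t, j) \<in> firsts t0" using t by (auto simp: firsts_def)
    then show ?thesis using \<open>l = x t j\<close> by blast
  qed
  show "\<not> t < t'" if *: "(t, j) \<in> firsts t0" "(t', j') \<in> firsts t0" "x t j = x t' j'" for t j t' j'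
  proof
    assume "t < t'"
    then have "x t' j' \<notin> layer t" "x t j \<in> layer t" using *(1,2) in_layer by (auto simp: firsts_def)
    then show False using *(3) by simp
  qed
qed

lemma card_lasts: "card (lasts t0) = card labels"
proof (rule card_one_per_label)
  show "j \<in> {1..m}" if "(t, j) \<in> lasts t0" for t j using that by (simp add: lasts_def)
  show "\<exists>(t, j)\<in>lasts t0. x t j = l" if l: "l \<in> labels" for l
  proof -
    define T where "T = {t. t \<in> {t0..t0 + 2 * k} \<and> l \<in> layer t}"
    have fin: "finite T" "T \<noteq> {}" using l labels_window[of t0] by (auto simp: T_def)
    define t where "t = Max T"
    have "t \<in> T" using fin by (simp add: t_def)
    then have t: "t \<in> {t0..t0 + 2 * k}" "l \<in> layer t" by (auto simp: T_def)
    have "l \<notin> layer r" if "r \<in> {t<..t0 + 2 * k}" for r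
    proof
      assume "l \<in> layer r"
      then have "r \<in> T" using that t by (auto simp: T_def)
      then have "r \<le> t" using fin by (simp add: t_def)
      then show False using that by simp
    qed
    moreover obtain j where "j \<in> {1..m}" "l = x t j" using t by (auto simp: layer_def)
    ultimately have "(t, j) \<in> lasts t0" using t by (auto simp: lasts_def)
    then show ?thesis using \<open>l = x t j\<close> by blast
  qed
  show "\<not> t < t'" if *: "(t, j) \<in> lasts t0" "(t', j') \<in> lasts t0" "x t j = x t' j'" for t j t' j'
  proof
    assume "t < t'"
    then have "x t j \<notin> layer t'" "x t' j' \<in> layer t'" using *(1,2) in_layer by (auto simp: lasts_def)
    then show False using *(3) by simp
  qed
qed

definition steps :: "nat \<Rightarrow> (nat \<times> nat) set" where
  "steps t0 = {t0..<t0 + 2 * k} \<times> {1..m}"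

definition first_steps :: "nat \<Rightarrow> (nat \<times> nat) set" where
  "first_steps t0 = {(t, j) \<in> steps t0. (Suc t, j) \<in> firsts t0}"

definition last_steps :: "nat \<Rightarrow> (nat \<times> nat) set" where
  "last_steps t0 = {(t, j) \<in> steps t0. (t, j) \<in> lasts t0}"

lemma finite_steps: "finite (steps t0)" "finite (first_steps t0)" "finite (last_steps t0)"
proof -
  show "finite (steps t0)" by (simp add: steps_def)
  then show "finite (first_steps t0)" "finite (last_steps t0)"
    by (rule rev_finite_subset; auto simp: first_steps_def last_steps_def)+
qed

lemma card_first_steps: "card labels = m + card (first_steps t0)"
proof -
  have "firsts t0 = ({t0} \<times> {1..m}) \<union> (\<lambda>(t, j). (Suc t, j)) ` first_steps t0"
  proof (intro equalityI subsetI)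
    fix p assume p: "p \<in> firsts t0"
    obtain t j where [simp]: "p = (t, j)" by (cases p)
    show "p \<in> ({t0} \<times> {1..m}) \<union> (\<lambda>(t, j). (Suc t, j)) ` first_steps t0"
    proof (cases "t = t0")
      case True then show ?thesis using p by (auto simp: firsts_def)
    next
      case False
      then have "t > t0" using p by (auto simp: firsts_def)
      then have "(t - 1, j) \<in> first_steps t0" "p = (Suc (t - 1), j)"
        using p by (auto simp: firsts_def first_steps_def steps_def)
      then show ?thesis by (intro UnI2 image_eqI[of _ _ "(t - 1, j)"]) simp_all
    qed
  qed (auto simp: firsts_def first_steps_def steps_def)
  moreover have "({t0} \<times> {1..m}) \<inter> (\<lambda>(t, j). (Suc t, j)) ` first_steps t0 = {}"
    by (auto simp: first_steps_def steps_def)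
  moreover have "card ((\<lambda>(t, j). (Suc t, j)) ` first_steps t0) = card (first_steps t0)"
    by (rule card_image) (auto simp: inj_on_def)
  ultimately have "card (firsts t0) = m + card (first_steps t0)"
    using finite_steps by (simp add: card_Un_disjoint card_cartesian_product)
  then show ?thesis using card_firsts by simp
qed

lemma card_last_steps: "card labels = m + card (last_steps t0)"
proof -
  have "lasts t0 = ({t0 + 2 * k} \<times> {1..m}) \<union> last_steps t0"
    by (auto simp: lasts_def last_steps_def steps_def)
  moreover have "({t0 + 2 * k} \<times> {1..m}) \<inter> last_steps t0 = {}"
    by (auto simp: last_steps_def steps_def)
  ultimately have "card (lasts t0) = m + card (last_steps t0)"
    using finite_steps by (simp add: card_Un_disjoint card_cartesian_product)
  then show ?thesis using card_lasts by simp
qed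

text \<open>
  An edge whose first end does not occur later and whose second end does not occur earlier cannot
  occur at any other step of the window.
\<close>

lemma no_first_after_last: "first_steps t0 \<inter> last_steps t0 = {}"
proof (rule ccontr)
  assume "first_steps t0 \<inter> last_steps t0 \<noteq> {}"
  then obtain t j where tj: "(t, j) \<in> steps t0" "(Suc t, j) \<in> firsts t0" "(t, j) \<in> lasts t0"
    by (auto simp: first_steps_def last_steps_def)
  then have j: "j \<in> {1..m}" and t: "t \<in> {t0..<t0 + 2 * k}" by (auto simp: steps_def)
  obtain t' p q where t': "t' \<in> {t0..<t0 + 2 * k}" "t' \<noteq> t" "p \<in> {1..m}" "q \<in> {1..m}"
    "{x t j, x (Suc t) j} = {x t' p, x (Suc t') q}"
    using repeated_in_window[OF j t] by metis
  have mem: "x t j \<in> layer t' \<union> layer (Suc t')" "x (Suc t) j \<in> layer t' \<union> layer (Suc t')"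
    using t'(5) in_layer t'(3,4) by (auto simp: doubleton_eq_iff)
  show False
  proof (cases "t' < t")
    case True
    then have "t' \<in> {t0..<Suc t}" "Suc t' \<in> {t0..<Suc t}" using t' t by auto
    then show False using mem(2) tj(2) by (auto simp: firsts_def)
  next
    case False
    then have "t' \<in> {t<..t0 + 2 * k}" "Suc t' \<in> {t<..t0 + 2 * k}" using t' t by auto
    then show False using mem(1) tj(3) by (auto simp: lasts_def)
  qed
qed

theorem card_labels_le: "card labels \<le> m * (k + 1)"
proof -
  have "card (first_steps 0) + card (last_steps 0) = card (first_steps 0 \<union> last_steps 0)"
    using no_first_after_last finite_steps by (simp add: card_Un_disjoint)
  also have "\<dots> \<le> card (steps 0)"
    by (rule card_mono) (auto simp: finite_steps first_steps_def last_steps_def)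
  also have "\<dots> = 2 * k * m" by (simp add: steps_def card_cartesian_product)
  finally show ?thesis using card_first_steps[of 0] card_last_steps[of 0] by (simp add: algebra_simps)
qed

end

section \<open>Labellings with the greatest number of labels\<close>

locale tight_walks = layered_walks +
  assumes tight: "card labels = m * (k + 1)"
begin

text \<open>
  Equality in the bound forces equality in every step, for every starting point of the window.
\<close>

lemma dichotomy:
  assumes "t \<in> {t0..<t0 + 2 * k}" "j \<in> {1..m}"
  shows "(t, j) \<in> lasts t0 \<longleftrightarrow> (Suc t, j) \<notin> firsts t0"
proof -
  have "card (first_steps t0 \<union> last_steps t0) = card (first_steps t0) + card (last_steps t0)"
    using no_first_after_last finite_steps by (simp add: card_Un_disjoint)
  moreover have "card (steps t0) = 2 * (m * k)" by (simp add: steps_def card_cartesian_product)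
  moreover have "m + card (first_steps t0) = m * k + m" "m + card (last_steps t0) = m * k + m"
    using card_first_steps[of t0] card_last_steps[of t0] tight by auto
  ultimately have "card (first_steps t0 \<union> last_steps t0) = card (steps t0)" by linarith
  then have "first_steps t0 \<union> last_steps t0 = steps t0"
    by (intro card_subset_eq) (auto simp: finite_steps first_steps_def last_steps_def)
  moreover have "(t, j) \<in> steps t0" using assms by (simp add: steps_def)
  ultimately show ?thesis using no_first_after_last[of t0] by (auto simp: first_steps_def last_steps_def)
qed

definition next_time :: "nat \<Rightarrow> nat \<Rightarrow> nat" where
  "next_time t j = (LEAST s. s > t \<and> x t j \<in> layer s)"

lemma next_time_basic:
  assumes "j \<in> {1..m}"
  shows "t + 2 \<le> next_time t j" "next_time t j \<le> t + 2 * k" "x t j \<in> layer (next_time t j)"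
    "r \<in> {t<..<next_time t j} \<Longrightarrow> x t j \<notin> layer r"
proof -
  have ex: "t + 2 * k > t \<and> x t j \<in> layer (t + 2 * k)"
    unfolding layer_period using k_pos in_layer[OF assms, of t] by auto
  have n: "next_time t j > t" "x t j \<in> layer (next_time t j)"
    using LeastI[of "\<lambda>s. s > t \<and> x t j \<in> layer s", OF ex] by (auto simp: next_time_def)
  then show "x t j \<in> layer (next_time t j)" by simp
  show "next_time t j \<le> t + 2 * k" using Least_le[of "\<lambda>s. s > t \<and> x t j \<in> layer s", OF ex] by (simp add: next_time_def)
  have "next_time t j \<noteq> Suc t" using n layer_disjoint[of t] in_layer[OF assms, of t] by auto
  then show "t + 2 \<le> next_time t j" using n by simp
  show "r \<in> {t<..<next_time t j} \<Longrightarrow> x t j \<notin> layer r"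
    using not_less_Least[of r "\<lambda>s. s > t \<and> x t j \<in> layer s"] by (auto simp: next_time_def)
qed

lemma next_time_eqI:
  assumes "s > t" "x t j \<in> layer s" "\<And>r. r \<in> {t<..<s} \<Longrightarrow> x t j \<notin> layer r"
  shows "next_time t j = s"
  unfolding next_time_def using assms by (intro Least_equality) (auto intro: leI)

lemma next_time_shift:
  assumes "j \<in> {1..m}"
  shows "next_time (t + 2 * k) j = next_time t j + 2 * k"
proof (rule next_time_eqI)
  note n = next_time_basic[OF assms, where t = t]
  show "t + 2 * k < next_time t j + 2 * k" using n by simp
  show "x (t + 2 * k) j \<in> layer (next_time t j + 2 * k)" using n layer_period period by simp
  fix r assume r: "r \<in> {t + 2 * k<..<next_time t j + 2 * k}"
  then have "x t j \<notin> layer (r - 2 * k)" by (intro n(4)) auto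
  then show "x (t + 2 * k) j \<notin> layer r" using r layer_diff[of r] period by simp
qed

text \<open>
  Let \<open>s\<close> be the next time at which \<open>x t j\<close> occurs. In the window that ends at \<open>s\<close> the occurrence at \<open>t\<close>
  is not the last one, so \<open>x (t + 1) j\<close> is new at \<open>t + 1\<close>. In the window that ends at \<open>s - 1\<close> it is the
  last one, so \<open>x (t + 1) j\<close> is not new. The two windows differ, before \<open>t\<close>, only in the layer
  \<open>s - 1 - 2k\<close>, which has the same labels as layer \<open>s - 1\<close>.
\<close>

lemma turn_back_aux:
  assumes j: "j \<in> {1..m}" and t: "t \<ge> 2 * k"
  defines "s \<equiv> next_time t j"
  shows "x (Suc t) j \<in> layer (s - 1)" "r \<in> {s - 2 * k..t} \<Longrightarrow> x (Suc t) j \<notin> layer r"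
proof -
  note n = next_time_basic[OF j, where t = t, folded s_def]
  have "(t, j) \<notin> lasts (s - 2 * k)"
    using n t by (auto simp: lasts_def)
  then have new: "(Suc t, j) \<in> firsts (s - 2 * k)"
    using dichotomy[of t "s - 2 * k" j] n j t by auto
  then show no: "r \<in> {s - 2 * k..t} \<Longrightarrow> x (Suc t) j \<notin> layer r" for r by (auto simp: firsts_def)
  show "x (Suc t) j \<in> layer (s - 1)"
  proof -
    \<comment> \<open>The window that ends at \<open>s - 1\<close>.\<close>
    have w: "s - 1 - 2 * k + 2 * k = s - 1" using n t k_pos by auto
    have "t \<in> {s - 1 - 2 * k..<s - 1 - 2 * k + 2 * k}" using n t by (simp add: w) auto
    then have "(Suc t, j) \<notin> firsts (s - 1 - 2 * k) \<longleftrightarrow> (t, j) \<in> lasts (s - 1 - 2 * k)"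
      using dichotomy j by blast
    moreover have "(t, j) \<in> lasts (s - 1 - 2 * k)" using n t j w by (auto simp: lasts_def)
    ultimately obtain r where r: "r \<in> {s - 1 - 2 * k..t}" "x (Suc t) j \<in> layer r"
      using n t j w by (auto simp: firsts_def less_Suc_eq_le)
    then have "r = s - 1 - 2 * k" using no by (cases "r \<ge> s - 2 * k") auto
    then show ?thesis using r layer_diff[of "s - 1"] w by simp
  qed
qed

lemma turn_back:
  assumes j: "j \<in> {1..m}"
  shows "x (Suc t) j \<in> layer (next_time t j - 1)"
    "r \<in> {next_time t j..t + 2 * k} \<Longrightarrow> x (Suc t) j \<notin> layer r"
proof -
  note sh = next_time_shift[OF j, of t]
  note n = next_time_basic(1)[OF j, of t]
  note aux = turn_back_aux[OF j, of "t + 2 * k", unfolded sh]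
  have "next_time t j + 2 * k - 1 = (next_time t j - 1) + 2 * k" using n by simp
  then show "x (Suc t) j \<in> layer (next_time t j - 1)"
    using aux(1) period[of "Suc t" j] layer_period by simp
  show "x (Suc t) j \<notin> layer r" if "r \<in> {next_time t j..t + 2 * k}"
    using aux(2)[of r] period[of "Suc t" j] that by simp
qed

text \<open>
  The edge of the step at \<open>t\<close> must occur again. Its ends exclude all steps of the following period
  except the one at \<open>s - 1\<close>, so the vertices found there are joined.
\<close>

lemma turn_back_adj:
  assumes j: "j \<in> {1..m}" and q: "q \<in> {1..m}" "x (next_time t j - 1) q = x (Suc t) j"
    and p: "p \<in> {1..m}" "x (next_time t j) p = x t j"
  shows "adj (next_time t j - 1) q p"
proof -
  define s where "s = next_time t j"
  note n = next_time_basic[OF j, where t = t, folded s_def]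
  note tb = turn_back[OF j, where t = t, folded s_def]
  have tw: "t \<in> {t..<t + 2 * k}" using k_pos by simp
  obtain t' p' q' where t': "t' \<in> {t..<t + 2 * k}" "t' \<noteq> t" "p' \<in> {1..m}" "q' \<in> {1..m}" "adj t' p' q'"
    "{x t j, x (Suc t) j} = {x t' p', x (Suc t') q'}"
    using repeated_in_window[OF j tw] by metis
  have mem: "x t j \<in> layer t' \<union> layer (Suc t')" "x (Suc t) j \<in> layer t' \<union> layer (Suc t')"
    using t'(6) in_layer[OF t'(3), of t'] in_layer[OF t'(4), of "Suc t'"] by (auto simp: doubleton_eq_iff)
  have "\<not> t' < s - 1"
  proof
    assume "t' < s - 1"
    then have "t' \<in> {t<..<s}" "Suc t' \<in> {t<..<s}" using t' by auto
    then show False using n(4) mem(1) by blast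
  qed
  moreover have "\<not> s \<le> t'"
  proof
    assume "s \<le> t'"
    then have "t' \<in> {s..t + 2 * k}" "Suc t' \<in> {s..t + 2 * k}" using t' by auto
    then show False using tb(2) mem(2) by blast
  qed
  ultimately have t'_eq: "t' = s - 1" "Suc t' = s" using n(1) by auto
  then have pair: "{x t j, x (Suc t) j} = {x (s - 1) p', x s q'}"
    using t'(6) by (simp only:)
  have "x t j \<noteq> x (s - 1) p'"
  proof -
    have "s - 1 \<in> {t<..<s}" using n(1) by auto
    then show ?thesis using n(4) in_layer[OF t'(3), of "s - 1"] by metis
  qed
  then have "x t j = x s q'" "x (Suc t) j = x (s - 1) p'"
    using pair by (auto simp: doubleton_eq_iff)
  then have "q' = p" "p' = q"
    using p q t'(3,4) inj_layer unfolding s_def by metis+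
  then show ?thesis using t'(5) t'_eq by (simp add: s_def)
qed

text \<open>
  A path has at most one perfect matching: here \<open>f\<close> moves indices in one direction only, while it
  preserves their sum.
\<close>

lemma matching_unique:
  fixes f :: "nat \<Rightarrow> nat"
  assumes f: "f ` {1..m} = {1..m}" and adj: "\<And>p. p \<in> {1..m} \<Longrightarrow> adj t (f p) p"
    and p: "p \<in> {1..m}"
  shows "f p = p"
proof -
  have inj: "inj_on f {1..m}" using f by (simp add: eq_card_imp_inj_on)
  have sum: "sum f {1..m} = sum id {1..m}"
    using sum.reindex[OF inj, of id] f by simp
  show ?thesis
  proof (cases "even t")
    case True
    then have "id p \<le> f p" if "p \<in> {1..m}" for p using adj[OF that] by (auto simp: adj_def)
    then show ?thesis using sum sum_mono_inv[of id "{1..m}" f p] p by simp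
  next
    case False
    then have "f p \<le> id p" if "p \<in> {1..m}" for p using adj[OF that] by (auto simp: adj_def)
    then show ?thesis using sum sum_mono_inv[of f "{1..m}" id p] p by simp
  qed
qed

lemma pred_exists:
  assumes p: "p \<in> {1..m}" and s: "s \<ge> 2 * k"
  shows "\<exists>t j. j \<in> {1..m} \<and> t < s \<and> x t j = x s p \<and> next_time t j = s"
proof -
  define T where "T = {t. t < s \<and> x s p \<in> layer t}"
  have "s - 2 * k \<in> T" using s k_pos in_layer[OF p, of s] layer_diff[OF s] by (auto simp: T_def)
  moreover have fin: "finite T" by (simp add: T_def)
  ultimately have "Max T \<in> T" by (intro Max_in) auto
  then have t: "Max T < s" "x s p \<in> layer (Max T)" by (auto simp: T_def)
  then obtain j where j: "j \<in> {1..m}" "x (Max T) j = x s p" by (auto simp: layer_def)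
  have "next_time (Max T) j = s"
  proof (rule next_time_eqI[OF t(1)])
    show "x (Max T) j \<in> layer s" using j in_layer[OF p] by simp
    show "x (Max T) j \<notin> layer r" if r: "r \<in> {Max T<..<s}" for r
    proof
      assume "x (Max T) j \<in> layer r"
      then have "r \<in> T" using r j by (simp add: T_def)
      then show False using r Max_ge[OF fin, of r] by simp
    qed
  qed
  then show ?thesis using j t by blast
qed

lemma next_time_inj:
  assumes "j \<in> {1..m}" "j' \<in> {1..m}" "x t j = x t' j'" "next_time t j = next_time t' j'"
  shows "t = t' \<and> j = j'"
proof -
  have "\<not> t < t'"
    using next_time_basic(4)[OF assms(1), of t' t] next_time_basic(1)[OF assms(2), of t'] in_layer[OF assms(2), of t'] assms(3,4)
    by auto
  moreover have "\<not> t' < t"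
    using next_time_basic(4)[OF assms(2), of t t'] next_time_basic(1)[OF assms(1), of t] in_layer[OF assms(1), of t] assms(3,4)
    by auto
  ultimately have "t = t'" by simp
  then show ?thesis using assms inj_layer by blast
qed

text \<open>
  Every vertex of layer \<open>s\<close> has a preceding occurrence of its label, and \<open>turn_back\<close> attaches to it a
  vertex of layer \<open>s - 1\<close>. Different vertices get different partners, because from a partner the
  preceding step can be recovered. So the partners form a perfect matching of the path between the
  layers \<open>s - 1\<close> and \<open>s\<close>, which must be the one that preserves the index.
\<close>

lemma mirror_aux:
  assumes j: "j \<in> {1..m}" and t: "t \<ge> 2 * k"
  shows "\<exists>p\<in>{1..m}. x (next_time t j) p = x t j \<and> x (next_time t j - 1) p = x (Suc t) j"
proof -
  define s where "s = next_time t j"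
  have s: "s \<ge> 2 * k" "s \<ge> 2" using next_time_basic(1)[OF j, of t] t by (auto simp: s_def)
  have "\<forall>p\<in>{1..m}. \<exists>v. snd v \<in> {1..m} \<and> fst v < s \<and> x (fst v) (snd v) = x s p \<and> next_time (fst v) (snd v) = s"
    using pred_exists[OF _ s(1)] by fastforce
  from bchoice[OF this] obtain v where v: "\<And>p. p \<in> {1..m} \<Longrightarrow> snd (v p) \<in> {1..m} \<and> fst (v p) < s \<and>
      x (fst (v p)) (snd (v p)) = x s p \<and> next_time (fst (v p)) (snd (v p)) = s"
    by blast
  define T J where "T = (\<lambda>p. fst (v p))" and "J = (\<lambda>p. snd (v p))"
  have TJ: "\<And>p. p \<in> {1..m} \<Longrightarrow> J p \<in> {1..m}" "\<And>p. p \<in> {1..m} \<Longrightarrow> T p < s"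
      "\<And>p. p \<in> {1..m} \<Longrightarrow> x (T p) (J p) = x s p" "\<And>p. p \<in> {1..m} \<Longrightarrow> next_time (T p) (J p) = s"
    using v unfolding T_def J_def by blast+
  have "\<exists>q. q \<in> {1..m} \<and> x (s - 1) q = x (Suc (T p)) (J p)" if "p \<in> {1..m}" for p
    using turn_back(1)[OF TJ(1)[OF that], of "T p"] TJ(4)[OF that] by (auto simp: layer_def)
  then obtain Q where Q: "\<And>p. p \<in> {1..m} \<Longrightarrow> Q p \<in> {1..m}"
    "\<And>p. p \<in> {1..m} \<Longrightarrow> x (s - 1) (Q p) = x (Suc (T p)) (J p)"
    by metis
  have inj: "inj_on Q {1..m}"
  proof (rule inj_onI)
    fix p p' assume p: "p \<in> {1..m}" "p' \<in> {1..m}" "Q p = Q p'"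
    have eq: "x (Suc (T p)) (J p) = x (Suc (T p')) (J p')" using Q(2) p by metis
    \<comment> \<open>The label of the common partner of \<open>a\<close> and \<open>b\<close> does not occur between \<open>s\<close> and \<open>T b + 2k\<close>, but it
      occurs at \<open>T a + 1\<close>.\<close>
    have le: "\<not> T a < T b" if ab: "a \<in> {1..m}" "b \<in> {1..m}" "x (Suc (T a)) (J a) = x (Suc (T b)) (J b)" for a b
    proof
      assume lt: "T a < T b"
      have "T b + 2 * k \<ge> s" using next_time_basic(2)[OF TJ(1)[OF ab(2)], of "T b"] TJ(4)[OF ab(2)] by simp
      then have "Suc (T a) + 2 * k \<in> {s..T b + 2 * k}"
        using lt next_time_basic(2)[OF TJ(1)[OF ab(1)], of "T a"] TJ(4)[OF ab(1)] by simp
      then have "x (Suc (T b)) (J b) \<notin> layer (Suc (T a) + 2 * k)"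
        using turn_back(2)[OF TJ(1)[OF ab(2)]] TJ(4)[OF ab(2)] by blast
      then have "x (Suc (T b)) (J b) \<notin> layer (Suc (T a))" by (simp only: layer_period not_False_eq_True)
      then show False using ab(3) in_layer[OF TJ(1)[OF ab(1)], of "Suc (T a)"] by simp
    qed
    have "T p = T p'" using le[OF p(1,2) eq] le[OF p(2,1) eq[symmetric]] by simp
    then have "J p = J p'" using inj_layer[OF TJ(1)[OF p(1)] TJ(1)[OF p(2)]] eq by simp
    then have "x s p = x s p'" using TJ(3) p \<open>T p = T p'\<close> by metis
    then show "p = p'" using inj_layer p by blast
  qed
  have img: "Q ` {1..m} = {1..m}"
    using Q(1) inj by (intro endo_inj_surj) auto
  have ad: "adj (s - 1) (Q p) p" if "p \<in> {1..m}" for p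
    using turn_back_adj[OF TJ(1)[OF that] Q(1)[OF that], of "T p" p] TJ(3,4)[OF that] Q(2)[OF that] that by simp
  obtain p where p: "p \<in> {1..m}" "x s p = x t j"
    using next_time_basic(3)[OF j, of t] by (auto simp: layer_def s_def)
  have "T p = t \<and> J p = j"
    using next_time_inj[OF TJ(1)[OF p(1)] j] TJ(3,4)[OF p(1)] p(2) by (simp add: s_def)
  then have "x (s - 1) p = x (Suc t) j"
    using matching_unique[OF img ad p(1)] Q(2)[OF p(1)] by simp
  then show ?thesis using p by (auto simp: s_def)
qed

lemma mirror:
  assumes j: "j \<in> {1..m}"
  shows "\<exists>p\<in>{1..m}. x (next_time t j) p = x t j \<and> x (next_time t j - 1) p = x (Suc t) j"
proof -
  have "next_time (t + 2 * k) j = next_time t j + 2 * k" "next_time (t + 2 * k) j - 1 = (next_time t j - 1) + 2 * k"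
    using next_time_shift[OF j, of t] next_time_basic(1)[OF j, of t] by auto
  then show ?thesis
    using mirror_aux[OF j, of "t + 2 * k"] period period[of "Suc t"] by simp
qed

text \<open>
  A label that is not new at step \<open>t\<close> was reached by a retracing step, and \<open>mirror\<close> exhibits the step
  that it retraces, at an earlier time and with the same index.
\<close>

lemma label_determines_walk_window:
  assumes "t \<le> 2 * k" "t' \<le> t" "j \<in> {1..m}" "j' \<in> {1..m}" "x t j = x t' j'"
  shows "j = j' \<and> (even t \<longleftrightarrow> even t')"
  using assms
proof (induction t arbitrary: t' j j' rule: less_induct)
  case (less t)
  show ?case
  proof (cases "t' = t")
    case True
    then show ?thesis using less.prems inj_layer by blast
  next
    case False
    then obtain u where u: "t = Suc u" "t' \<le> u" "u < 2 * k" using less.prems by (cases t) auto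
    have "(Suc u, j) \<notin> firsts 0"
      using less.prems u in_layer[OF less.prems(4), of t'] by (force simp: firsts_def)
    then have last: "(u, j) \<in> lasts 0" using dichotomy[of u 0 j] u less.prems(3) by auto
    define s where "s = next_time u j"
    note n = next_time_basic[OF less.prems(3), where t = u, folded s_def]
    have "s > 2 * k"
    proof (rule ccontr)
      assume "\<not> s > 2 * k"
      then have "s \<in> {u<..0 + 2 * k}" using n(1) by simp
      then show False using last n(3) by (auto simp: lasts_def)
    qed
    then have s': "s - 2 * k \<le> u" "s - 2 * k \<ge> 1" "s \<ge> 2 * k" using n(2) by auto
    obtain p where p: "p \<in> {1..m}" "x s p = x u j" "x (s - 1) p = x t j"
      using mirror[OF less.prems(3), of u] u(1) by (auto simp: s_def)
    have "x u j = x (s - 2 * k) p" using p(2) period_diff[OF s'(3)] by simp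
    then have jp: "j = p" "even u \<longleftrightarrow> even (s - 2 * k)"
      using less.IH[of u "s - 2 * k" j p] u s' less.prems(3) p(1) by auto
    define v where "v = s - 1 - 2 * k"
    have v: "v < u" "Suc v = s - 2 * k" using s' \<open>s > 2 * k\<close> by (auto simp: v_def)
    have "s - 1 \<ge> 2 * k" using \<open>s > 2 * k\<close> by simp
    then have "x v p = x t j" using p(3) period_diff[of "s - 1" p] by (simp add: v_def)
    then have eq: "x v j = x t' j'" using jp less.prems(5) by simp
    have "j = j' \<and> (even v \<longleftrightarrow> even t')"
    proof (cases "t' \<le> v")
      case True
      then show ?thesis using less.IH[of v t' j j'] v u less.prems(3,4) eq by auto
    next
      case False
      then show ?thesis using less.IH[of t' v j' j] v u less.prems(3,4) eq by auto
    qed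
    then show ?thesis using jp(2) v u by (metis even_Suc)
  qed
qed

lemma label_determines_walk:
  assumes "j \<in> {1..m}" "j' \<in> {1..m}" "x t j = x t' j'"
  shows "j = j'" "even t \<longleftrightarrow> even t'"
proof -
  have pos: "2 * k > 0" using k_pos by simp
  define a b where "a = t mod (2 * k)" and "b = t' mod (2 * k)"
  have ab: "a \<le> 2 * k" "b \<le> 2 * k" using pos by (auto simp: a_def b_def less_imp_le)
  have eq: "x a j = x b j'"
    using assms(3) period_mod[of a t j] period_mod[of b t' j'] by (simp add: a_def b_def)
  have "j = j' \<and> (even a \<longleftrightarrow> even b)"
  proof (cases "b \<le> a")
    case True then show ?thesis using label_determines_walk_window[OF ab(1) True assms(1,2) eq] by simp
  next
    case False then show ?thesis using label_determines_walk_window[OF ab(2) _ assms(2,1) eq[symmetric]] by simp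
  qed
  moreover have "even a \<longleftrightarrow> even t" "even b \<longleftrightarrow> even t'"
    using parity_mod[of a t] parity_mod[of b t'] by (auto simp: a_def b_def)
  ultimately show "j = j'" "even t \<longleftrightarrow> even t'" by auto
qed

lemma next_time_same:
  assumes j: "j \<in> {1..m}"
  shows "x (next_time t j) j = x t j" "x (next_time t j - 1) j = x (Suc t) j" "even (next_time t j) \<longleftrightarrow> even t"
proof -
  obtain p where p: "p \<in> {1..m}" "x (next_time t j) p = x t j" "x (next_time t j - 1) p = x (Suc t) j"
    using mirror[OF j] by blast
  have "p = j" using label_determines_walk(1)[OF p(1) j p(2)] .
  then show "x (next_time t j) j = x t j" "x (next_time t j - 1) j = x (Suc t) j" using p by auto
  show "even (next_time t j) \<longleftrightarrow> even t" using label_determines_walk(2)[OF p(1) j p(2)] .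
qed

text \<open>
  Until \<open>x t j\<close> recurs, the walk stays in the part of the tree that it has just entered. Each label
  there is new in the window that ends at the recurrence, or it is reached by retracing a step that
  was made after \<open>t\<close>.
\<close>

lemma nested_aux:
  assumes j: "j \<in> {1..m}" and t: "t \<ge> 2 * k"
    and r: "r \<in> {t<..<next_time t j}" and r': "r' \<in> {next_time t j - 2 * k..t}"
  shows "x r j \<notin> layer r'"
proof -
  define s where "s = next_time t j"
  note n = next_time_basic[OF j, where t = t, folded s_def]
  have t0: "s - 2 * k + 2 * k = s" "s - 2 * k \<le> t" using n t by auto
  have "\<forall>r'\<in>{s - 2 * k..t}. x r j \<notin> layer r'" if "t < r" "r < s" for r
    using that
  proof (induction r rule: less_induct)
    case (less r)
    show ?case
    proof
      fix r' assume r': "r' \<in> {s - 2 * k..t}"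
      obtain u where u: "r = Suc u" "t \<le> u" using less.prems by (cases r) auto
      show "x r j \<notin> layer r'"
      proof (cases "u = t")
        case True
        then show ?thesis using turn_back_aux(2)[OF j t, of r'] u r' by (simp add: s_def)
      next
        case False
        then have "t < u" using u by simp
        show ?thesis
        proof (cases "(r, j) \<in> firsts (s - 2 * k)")
          case True
          then show ?thesis using r' less.prems by (auto simp: firsts_def)
        next
          case False
          have "u \<in> {s - 2 * k..<s - 2 * k + 2 * k}" unfolding t0 using t0 less.prems u by auto
          then have last: "(u, j) \<in> lasts (s - 2 * k)" using dichotomy False j u by blast
          define w where "w = next_time u j"
          note nw = next_time_basic[OF j, where t = u, folded w_def]
          have "w > s"
          proof (rule ccontr)
            assume "\<not> w > s"
            then have "w \<in> {u<..s - 2 * k + 2 * k}" using nw(1) t0 by simp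
            then show False using last nw(3) by (auto simp: lasts_def)
          qed
          then have w: "w \<ge> 2 * k" "w - 1 \<ge> 2 * k" "w - 2 * k \<ge> s - 2 * k" using n t by auto
          have mem: "x u j \<in> layer (w - 2 * k)" using nw(3) layer_diff[OF w(1)] by simp
          have "w - 2 * k > t"
          proof (rule ccontr)
            assume "\<not> w - 2 * k > t"
            then have "w - 2 * k \<in> {s - 2 * k..t}" using w by simp
            then show False using less.IH[of u] mem \<open>t < u\<close> u less.prems by auto
          qed
          define v where "v = w - 1 - 2 * k"
          have v: "v \<ge> t" "v < u" using \<open>w - 2 * k > t\<close> nw(2) k_pos by (auto simp: v_def)
          have eq: "x v j = x r j"
            using next_time_same(2)[OF j, of u] period_diff[OF w(2), of j] u by (simp add: w_def v_def)
          have "v \<noteq> t"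
          proof
            assume "v = t"
            then have "x t j \<in> layer r" using eq in_layer[OF j, of r] by simp
            then show False using n(4)[of r] less.prems by auto
          qed
          then show ?thesis using less.IH[of v] v u less.prems eq r' by auto
        qed
      qed
    qed
  qed
  then show ?thesis using r r' by (simp add: s_def)
qed

lemma nested:
  assumes j: "j \<in> {1..m}" and r: "r \<in> {t<..<next_time t j}" and r': "r' \<in> {next_time t j..t + 2 * k}"
  shows "x r j \<noteq> x r' j"
proof -
  note sh = next_time_shift[OF j, of t]
  have "x (r + 2 * k) j \<notin> layer r'"
    by (rule nested_aux[OF j, of "t + 2 * k"]) (use r r' sh in auto)
  then show ?thesis using period[of r j] in_layer[OF j, of r'] by auto
qed

subsection \<open>Noncrossing structure of a single walk\<close>

text \<open>
  Times \<open>t1 < t2 < t3 \<le> t4\<close> within one period: take the last occurrence of \<open>x t1 j\<close> before \<open>t2\<close>; then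
  \<open>t2\<close> lies strictly between it and the next recurrence, and \<open>t4\<close> does not.
\<close>

lemma noncrossing:
  assumes j: "j \<in> {1..m}" and t: "t1 < t2" "t2 < t3" "t3 \<le> t4" "t4 \<le> t1 + 2 * k"
    and eq: "x t1 j = x t3 j" "x t2 j = x t4 j"
  shows "x t1 j = x t2 j"
proof (rule ccontr)
  assume ne: "x t1 j \<noteq> x t2 j"
  define T where "T = {t. t1 \<le> t \<and> t < t2 \<and> x t j = x t1 j}"
  have fin: "finite T" and "t1 \<in> T" using t by (auto simp: T_def)
  then have "Max T \<in> T" by (intro Max_in) auto
  then obtain t where t_def: "t = Max T" "t1 \<le> t" "t < t2" "x t j = x t1 j" by (auto simp: T_def)
  define s where "s = next_time t j"
  note n = next_time_basic[OF j, where t = t, folded s_def]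
  have "s \<le> t3"
  proof (rule ccontr)
    assume "\<not> s \<le> t3"
    then have "x t j \<notin> layer t3" using n(4) t t_def by auto
    then show False using eq(1) t_def in_layer[OF j, of t3] by simp
  qed
  moreover have "t2 < s"
  proof (rule ccontr)
    assume "\<not> t2 < s"
    moreover have "x s j = x t1 j" using next_time_same(1)[OF j, of t] t_def by (simp add: s_def)
    ultimately have "s \<in> T \<or> s = t2" using n(1) t_def by (auto simp: T_def)
    then show False
      using Max_ge[OF fin, of s] t_def n(1) ne \<open>x s j = x t1 j\<close> by auto
  qed
  ultimately have "x t2 j \<noteq> x t4 j"
    using nested[OF j, of t2 t t4] t t_def by (auto simp: s_def)
  then show False using eq by simp
qed

text \<open>
  Equal \<open>b\<close>-labels at \<open>i\<close> and \<open>i'\<close> make the \<open>a\<close>-times between them a union of classes, since the labels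
  of the two kinds of layers are different.
\<close>

lemma complement_aux:
  assumes j: "j \<in> {1..m}" and i: "i < i'" "i' < k" and s: "s \<in> {i<..i'}" and u: "u < k"
    and eq: "x (2 * i + 1) j = x (2 * i' + 1) j" "x (2 * u) j = x (2 * s) j"
  shows "u \<in> {i<..i'}"
proof (rule ccontr)
  assume "u \<notin> {i<..i'}"
  then consider "u \<le> i" | "u > i'" by force
  then have "x (2 * i + 1) j = x (2 * s) j"
  proof cases
    case 1
    show ?thesis
      by (rule noncrossing[OF j, of _ _ "2 * i' + 1" "2 * u + 2 * k"]) (use 1 i s eq period in auto)
  next
    case 2
    show ?thesis
      by (rule noncrossing[OF j, of _ _ "2 * i' + 1" "2 * u"]) (use 2 i s u eq in auto)
  qed
  then show False using label_determines_walk(2)[OF j j, of "2 * i + 1" "2 * s"] by simp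
qed

text \<open>
  The \<open>b\<close>-label at \<open>i\<close> recurs right after the last time of the \<open>a\<close>-label at \<open>i + 1\<close>. That time lies
  in the interval, because the interval is a union of classes, and the rest of the interval is again a
  union of classes.
\<close>

lemma complement_converse:
  assumes j: "j \<in> {1..m}" and "i < i'" "i' < k"
    and "\<And>s u. s \<in> {i<..i'} \<Longrightarrow> u < k \<Longrightarrow> x (2 * u) j = x (2 * s) j \<Longrightarrow> u \<in> {i<..i'}"
  shows "x (2 * i + 1) j = x (2 * i' + 1) j"
  using assms(2-)
proof (induction "i' - i" arbitrary: i rule: less_induct)
  case less
  define s where "s = next_time (2 * i + 1) j"
  note n = next_time_basic[OF j, where t = "2 * i + 1", folded s_def]
  note same = next_time_same[OF j, of "2 * i + 1", folded s_def]
  have "odd s" using same(3) by simp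
  then obtain l where l: "s = 2 * l + 1" by (auto elim: oddE)
  have l_bounds: "i < l" "l \<le> i + k" using n(1,2) l by auto
  have eqA: "x (2 * l) j = x (2 * (i + 1)) j" using same(2) l by simp
  have eqB: "x (2 * l + 1) j = x (2 * i + 1) j" using same(1) l by simp
  have "l < k"
  proof (rule ccontr)
    assume "\<not> l < k"
    then have "x (2 * (l - k)) j = x (2 * (i + 1)) j"
      using eqA period[of "2 * (l - k)" j] by (simp add: algebra_simps)
    moreover have "l - k \<le> i" "l - k < k" using l_bounds less.prems(1,2) \<open>\<not> l < k\<close> by auto
    ultimately show False
      using less.prems(3)[of "i + 1" "l - k"] less.prems(1,2) by auto
  qed
  then have l': "l \<in> {i<..i'}"
    using less.prems(3)[of "i + 1" l] eqA l_bounds less.prems(1,2) \<open>l < k\<close> by auto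
  show ?case
  proof (cases "l = i'")
    case True
    then show ?thesis using eqB by simp
  next
    case False
    have "x (2 * l + 1) j = x (2 * i' + 1) j"
    proof (rule less.hyps)
      show "i' - l < i' - i" "l < i'" "i' < k" using l' False less.prems(2) by auto
      fix v u assume *: "v \<in> {l<..i'}" "u < k" "x (2 * u) j = x (2 * v) j"
      have u: "u \<in> {i<..i'}" using less.prems(3)[of v u] * l' by auto
      have "u \<notin> {i<..l}"
        using complement_aux[OF j l_bounds(1) \<open>l < k\<close>, of u v] eqB * l' less.prems(2) by auto
      then show "u \<in> {l<..i'}" using u by auto
    qed
    then show ?thesis using eqB by simp
  qed
qed

lemma complement:
  assumes j: "j \<in> {1..m}" and i: "i < k" "i' < k"
  shows "x (2 * i + 1) j = x (2 * i' + 1) j \<longleftrightarrow>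
    cut k (\<lambda>i. x (2 * i) j) i = cut k (\<lambda>i. x (2 * i) j) i'"
proof -
  have *: "x (2 * i + 1) j = x (2 * i' + 1) j \<longleftrightarrow>
    cut k (\<lambda>i. x (2 * i) j) i = cut k (\<lambda>i. x (2 * i) j) i'" if "i < i'" "i' < k" for i i'
    unfolding cut_eq_iff[OF less_imp_le[OF that(1)] that(2)]
  proof
    assume "x (2 * i + 1) j = x (2 * i' + 1) j"
    then show "\<forall>s\<in>{i<..i'}. \<forall>u<k. x (2 * u) j = x (2 * s) j \<longrightarrow> u \<in> {i<..i'}"
      using complement_aux[OF j that] by blast
  next
    assume "\<forall>s\<in>{i<..i'}. \<forall>u<k. x (2 * u) j = x (2 * s) j \<longrightarrow> u \<in> {i<..i'}"
    then show "x (2 * i + 1) j = x (2 * i' + 1) j"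
      by (intro complement_converse[OF j that]) blast
  qed
  show ?thesis
    using *[of i i'] *[of i' i] i by (cases i i' rule: linorder_cases) auto
qed

text \<open>
  Between two occurrences of an \<open>a\<close>-label of walk \<open>j\<close>, the \<open>b\<close>-labels of walk \<open>j\<close> are confined to the
  interval. Hence the edges that lead from a label \<open>\<alpha>\<close> of another walk \<open>j'\<close> to these \<open>b\<close>-labels are
  exactly those inside the interval, and their number is even. Every inner occurrence of \<open>\<alpha>\<close>
  contributes two such edges and the two ends contribute one each, so \<open>\<alpha>\<close> occurs at both ends or at
  none.
\<close>

lemma refinement:
  assumes j: "j \<in> {1..m}" and i: "i < i'" "i' < k" and eq: "x (2 * i) j = x (2 * i') j"
    and even: "\<And>\<alpha> \<beta>. even (card {l. l < k \<and> x (2 * l) j' = \<alpha> \<and> x (2 * l + 1) j = \<beta>} +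
      card {l. l < k \<and> x (2 * l + 2) j' = \<alpha> \<and> x (2 * l + 1) j = \<beta>})"
  shows "x (2 * i) j' = x (2 * i') j'"
proof -
  define B where "B = (\<lambda>l. x (2 * l + 1) j) ` {i..<i'}"
  define \<alpha> where "\<alpha> = x (2 * i) j'"
  have B: "x (2 * l + 1) j \<in> B \<longleftrightarrow> l \<in> {i..<i'}" if l: "l < k" for l
  proof
    assume "x (2 * l + 1) j \<in> B"
    then obtain l' where l': "l' \<in> {i..<i'}" "x (2 * l' + 1) j = x (2 * l + 1) j" by (auto simp: B_def)
    show "l \<in> {i..<i'}"
    proof (rule ccontr)
      assume "l \<notin> {i..<i'}"
      then consider "l < i" | "l \<ge> i'" by force
      then have "x (2 * i) j = x (2 * l' + 1) j"
      proof cases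
        case 1
        show ?thesis
          by (rule noncrossing[OF j, of _ _ "2 * i'" "2 * l + 1 + 2 * k"]) (use 1 i l' eq period[of "2 * l + 1"] in auto)
      next
        case 2
        show ?thesis
          by (rule noncrossing[OF j, of _ _ "2 * i'" "2 * l + 1"]) (use 2 i l l' eq in auto)
      qed
      then show False using label_determines_walk(2)[OF j j, of "2 * i" "2 * l' + 1"] by simp
    qed
  qed (auto simp: B_def)
  have card_B: "(\<Sum>\<beta>\<in>B. card {l. l < k \<and> P l \<and> x (2 * l + 1) j = \<beta>}) = (\<Sum>l\<in>{i..<i'}. of_bool (P l))" for P
  proof -
    have "(\<Sum>\<beta>\<in>B. card {l. l < k \<and> P l \<and> x (2 * l + 1) j = \<beta>}) =
      card (\<Union>\<beta>\<in>B. {l. l < k \<and> P l \<and> x (2 * l + 1) j = \<beta>})"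
      by (rule card_UN_disjoint[symmetric]) (auto simp: B_def)
    also have "(\<Union>\<beta>\<in>B. {l. l < k \<and> P l \<and> x (2 * l + 1) j = \<beta>}) = {l \<in> {i..<i'}. P l}"
      using B i by auto
    finally show ?thesis by (simp add: sum.If_cases of_bool_def Int_def)
  qed
  have "even (\<Sum>\<beta>\<in>B. card {l. l < k \<and> x (2 * l) j' = \<alpha> \<and> x (2 * l + 1) j = \<beta>} +
      card {l. l < k \<and> x (2 * l + 2) j' = \<alpha> \<and> x (2 * l + 1) j = \<beta>})"
    using even by (intro dvd_sum) blast
  then have sum_even: "even (\<Sum>l\<in>{i..<i'}. of_bool (x (2 * l) j' = \<alpha>) + of_bool (x (2 * l + 2) j' = \<alpha>) :: nat)"
    unfolding sum.distrib card_B[of "\<lambda>l. x (2 * l) j' = \<alpha>"] card_B[of "\<lambda>l. x (2 * l + 2) j' = \<alpha>"] .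
  have telescope: "even (\<Sum>l\<in>{a..<b}. c l + c (Suc l)) \<longleftrightarrow> even (c a + c b)"
    if "a \<le> b" for a b and c :: "nat \<Rightarrow> nat"
    using that by (induction b rule: dec_induct) auto
  have "even (of_bool (x (2 * i) j' = \<alpha>) + of_bool (x (2 * i') j' = \<alpha>) :: nat)"
    using telescope[of i i' "\<lambda>l. of_bool (x (2 * l) j' = \<alpha>)"] sum_even i(1) by simp
  then show ?thesis by (auto simp: \<alpha>_def of_bool_def split: if_splits)
qed

end

section \<open>Constraint graphs as forests\<close>

lemma equiv_conn: "equiv V (conn V C)"
proof (rule equivI)
  show "conn V C \<subseteq> V \<times> V" by (auto simp: conn_def)
  show "refl_on V (conn V C)" by (auto simp: conn_def refl_on_def)
  have "sym ({(x, y). {x, y} \<in> C}\<^sup>*)"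
    by (rule sym_rtrancl) (auto simp: sym_def insert_commute)
  then show "sym (conn V C)" by (auto simp: conn_def sym_def)
  show "trans (conn V C)" by (auto simp: conn_def trans_def intro: rtrancl_trans)
qed

text \<open>
  Paths without repeated vertices are needed because a cycle has to consist of distinct vertices.
\<close>

lemma connected_imp_path:
  assumes "(u, v) \<in> {(x, y). {x, y} \<in> C}\<^sup>*"
  shows "\<exists>xs. xs \<noteq> [] \<and> hd xs = u \<and> last xs = v \<and> distinct xs \<and> successively (\<lambda>x y. {x, y} \<in> C) xs"
  using assms
proof (induction rule: rtrancl_induct)
  case base
  show ?case by (intro exI[of _ "[u]"]) simp
next
  case (step y z)
  then obtain xs where xs: "xs \<noteq> []" "hd xs = u" "last xs = y" "distinct xs"
    "successively (\<lambda>x y. {x, y} \<in> C) xs" by blast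
  show ?case
  proof (cases "z \<in> set xs")
    case True
    then obtain as bs where as: "xs = (as @ [z]) @ bs" by (metis append.assoc append_Cons append_Nil split_list)
    have "hd (as @ [z]) = u" using xs(2) as by (cases as) auto
    moreover have "successively (\<lambda>x y. {x, y} \<in> C) (as @ [z])"
      using xs(5) unfolding as successively_append_iff by blast
    ultimately show ?thesis using xs(4) as by (intro exI[of _ "as @ [z]"]) auto
  next
    case False
    then show ?thesis using xs step.hyps(2)
      by (intro exI[of _ "xs @ [z]"]) (auto simp: successively_append_iff)
  qed
qed

lemma constraint_graph_subset:
  "constraint_graph V C \<Longrightarrow> D \<subseteq> C \<Longrightarrow> constraint_graph V D"
proof -
  assume C: "constraint_graph V C" and D: "D \<subseteq> C"
  have "is_cycle C xs" if "is_cycle D xs" for xs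
    using that D unfolding is_cycle_def by (auto elim!: successively_mono)
  then have "\<nexists>xs. is_cycle D xs" using C unfolding constraint_graph_def by metis
  moreover have "simple_graph_on V D" using C D by (auto simp: constraint_graph_def simple_graph_on_def)
  ultimately show ?thesis by (simp add: constraint_graph_def)
qed

lemma new_edge_not_connected:
  assumes C: "constraint_graph V (insert {u, v} C)" and new: "{u, v} \<notin> C" "u \<noteq> v"
  shows "(u, v) \<notin> conn V C"
proof
  assume "(u, v) \<in> conn V C"
  then obtain xs where xs: "xs \<noteq> []" "hd xs = u" "last xs = v" "distinct xs"
    "successively (\<lambda>x y. {x, y} \<in> C) xs"
    using connected_imp_path[of u v C] by (auto simp: conn_def)
  have "length xs \<ge> 3"
  proof (rule ccontr)
    assume "\<not> length xs \<ge> 3"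
    moreover have "length xs \<noteq> 0" using xs(1) by simp
    ultimately have "length xs = 1 \<or> length xs = 2" by linarith
    then consider a where "xs = [a]" | a b where "xs = [a, b]"
      by (auto simp: length_Suc_conv numeral_2_eq_2)
    then show False using xs new by cases auto
  qed
  then have "is_cycle (insert {u, v} C) xs"
    using xs by (auto simp: is_cycle_def insert_commute elim!: successively_mono)
  then show False using C by (auto simp: constraint_graph_def)
qed

lemma conn_insert:
  assumes "u \<in> V" "v \<in> V"
  shows "conn V (insert {u, v} C) =
    conn V C \<union> (conn V C `` {u}) \<times> (conn V C `` {v}) \<union> (conn V C `` {v}) \<times> (conn V C `` {u})"
proof -
  let ?E = "{(x, y). {x, y} \<in> C}"
  have sym: "(a, b) \<in> ?E\<^sup>* \<longleftrightarrow> (b, a) \<in> ?E\<^sup>*" for a b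
    using sym_rtrancl[of ?E] by (auto simp: sym_def insert_commute)
  have E: "{(x, y). {x, y} \<in> insert {u, v} C} = insert (u, v) (insert (v, u) ?E)"
    by (auto simp: doubleton_eq_iff)
  have from_common: "(a, b) \<in> ?E\<^sup>*" if "(c, a) \<in> ?E\<^sup>*" "(c, b) \<in> ?E\<^sup>*" for a b c
  proof -
    have "(a, c) \<in> ?E\<^sup>*" using that(1) sym by blast
    then show ?thesis using that(2) by (rule rtrancl_trans)
  qed
  show ?thesis
    unfolding conn_def E rtrancl_insert using assms
    by (auto simp: sym[of _ u] sym[of _ v] intro: from_common)
qed

text \<open>
  The relation on the right merges the classes of \<open>u\<close> and \<open>v\<close>.
\<close>

lemma card_quotient_merge:
  assumes V: "finite V" and R: "equiv V R" and uv: "u \<in> V" "v \<in> V" "(u, v) \<notin> R"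
  shows "card (V // R) = Suc (card (V // (R \<union> (R `` {u}) \<times> (R `` {v}) \<union> (R `` {v}) \<times> (R `` {u}))))"
proof -
  define R' where "R' = R \<union> (R `` {u}) \<times> (R `` {v}) \<union> (R `` {v}) \<times> (R `` {u})"
  have ne: "R `` {u} \<noteq> R `` {v}" using uv R by (simp add: eq_equiv_class_iff)
  have self: "x \<in> R `` {x}" if "x \<in> V" for x using that R by (rule equiv_class_self[rotated])
  have disj: "R `` {u} \<inter> R `` {v} = {}"
    using quotient_disj[OF R quotientI quotientI] uv ne by metis
  have img: "R' `` {x} = (if x \<in> R `` {u} \<union> R `` {v} then R `` {u} \<union> R `` {v} else R `` {x})"
    if "x \<in> V" for x
  proof -
    have "R `` {x} = R `` {u}" if "x \<in> R `` {u}" using that R equiv_class_eq[OF R, of u x] by auto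
    moreover have "R `` {x} = R `` {v}" if "x \<in> R `` {v}" using that R equiv_class_eq[OF R, of v x] by auto
    ultimately show ?thesis using disj by (auto simp: R'_def)
  qed
  have "V // R' = insert (R `` {u} \<union> R `` {v}) (V // R - {R `` {u}, R `` {v}})"
  proof (intro equalityI subsetI)
    fix X assume "X \<in> V // R'"
    then obtain x where x: "x \<in> V" "X = R' `` {x}" by (auto elim: quotientE)
    show "X \<in> insert (R `` {u} \<union> R `` {v}) (V // R - {R `` {u}, R `` {v}})"
      using x img[OF x(1)] self[OF x(1)] by (auto intro: quotientI)
  next
    fix X assume X: "X \<in> insert (R `` {u} \<union> R `` {v}) (V // R - {R `` {u}, R `` {v}})"
    show "X \<in> V // R'"
    proof (cases "X = R `` {u} \<union> R `` {v}")
      case True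
      then have "X = R' `` {u}" using img[OF uv(1)] self[OF uv(1)] by simp
      then show ?thesis using uv by (auto intro: quotientI)
    next
      case False
      then have X': "X \<in> V // R" "X \<noteq> R `` {u}" "X \<noteq> R `` {v}" using X by auto
      then obtain x where x: "x \<in> V" "X = R `` {x}" "X \<noteq> R `` {u}" "X \<noteq> R `` {v}"
        using quotientE[OF X'(1)] by metis
      then have "x \<notin> R `` {u}" "x \<notin> R `` {v}"
        using equiv_class_eq[OF R, of u x] equiv_class_eq[OF R, of v x] by auto
      then have "X = R' `` {x}" using img[OF x(1)] x by simp
      then show ?thesis using x by (auto intro: quotientI)
    qed
  qed
  moreover have "R `` {u} \<union> R `` {v} \<notin> V // R"
  proof
    assume *: "R `` {u} \<union> R `` {v} \<in> V // R"
    have "R `` {u} \<union> R `` {v} = R `` {u}"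
      using quotient_disj[OF R * quotientI[OF uv(1)]] self[OF uv(1)] by blast
    then show False using self[OF uv(2)] disj by blast
  qed
  moreover have fin: "finite (V // R)" by (rule finite_quotient[OF V]) (use R in \<open>auto simp: equiv_def\<close>)
  ultimately have "card (V // R') = Suc (card (V // R - {R `` {u}, R `` {v}}))" by simp
  also have "card (V // R - {R `` {u}, R `` {v}}) = card (V // R) - card {R `` {u}, R `` {v}}"
    by (rule card_Diff_subset) (use uv in \<open>auto intro: quotientI\<close>)
  also have "card {R `` {u}, R `` {v}} = 2" using ne by simp
  finally have "card (V // R') = Suc (card (V // R) - 2)" .
  moreover have "card (V // R) \<ge> card {R `` {u}, R `` {v}}"
    by (rule card_mono[OF fin]) (use uv in \<open>auto intro: quotientI\<close>)
  ultimately show ?thesis using ne by (simp add: R'_def)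
qed

lemma card_forest:
  assumes V: "finite V" and C: "constraint_graph V C"
  shows "card C + card (V // conn V C) = card V"
proof -
  have "finite C"
    by (rule finite_subset[of _ "Pow V"])
      (use V C in \<open>auto simp: constraint_graph_def simple_graph_on_def\<close>)
  then show ?thesis using C
  proof (induction C rule: finite_induct)
    case empty
    have "V // conn V {} = (\<lambda>x. {x}) ` V" by (auto simp: conn_def quotient_def Image_def)
    then show ?case by (simp add: card_image)
  next
    case (insert e F)
    obtain u v where uv: "e = {u, v}" "u \<in> V" "v \<in> V" "u \<noteq> v"
      using insert.prems by (auto simp: constraint_graph_def simple_graph_on_def)
    have F: "constraint_graph V F" using insert.prems constraint_graph_subset by blast
    have "(u, v) \<notin> conn V F"
      using new_edge_not_connected[of V u v F] insert uv by simp
    then have "card (V // conn V F) = Suc (card (V // conn V (insert e F)))"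
      unfolding uv(1) conn_insert[OF uv(2,3)]
      by (intro card_quotient_merge[OF V equiv_conn uv(2,3)])
    then show ?case using insert.IH[OF F] insert.hyps by simp
  qed
qed

text \<open>
  Take a star in each class, centred at a chosen representative. There is no cycle: every other vertex
  on it would fail to be a representative, but such a vertex has only one neighbour.
\<close>

lemma equiv_is_conn:
  assumes R: "equiv V R"
  shows "\<exists>C. constraint_graph V C \<and> conn V C = R"
proof -
  define rep where "rep a = (SOME y. y \<in> R `` {a})" for a
  define C where "C = {{a, rep a} | a. a \<in> V \<and> rep a \<noteq> a}"
  have RV: "R \<subseteq> V \<times> V" using R by (auto simp: equiv_def refl_on_def)
  have rep: "(a, rep a) \<in> R" if "a \<in> V" for a
    using someI[of "\<lambda>y. y \<in> R `` {a}" a] equiv_class_self[OF R that] by (simp add: rep_def)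
  have rep_eq: "rep a = rep b" if "(a, b) \<in> R" for a b
    using equiv_class_eq[OF R that] by (simp add: rep_def)
  have idem: "rep (rep a) = rep a" if "a \<in> V" for a using rep_eq[OF rep[OF that]] by simp
  have nbr: "b = rep a" if "{a, b} \<in> C" "rep a \<noteq> a" for a b
    using that idem by (auto simp: C_def doubleton_eq_iff)
  have nbr': "rep b \<noteq> b" if "{a, b} \<in> C" "rep a = a" for a b
    using that idem by (auto simp: C_def doubleton_eq_iff)
  have no_cycle: "\<not> is_cycle C xs" for xs
  proof
    assume cyc: "is_cycle C xs"
    then obtain a b c ys where xs: "xs = a # b # c # ys"
      unfolding is_cycle_def by (cases xs; cases "tl xs"; cases "tl (tl xs)") auto
    have e: "{a, b} \<in> C" "{b, c} \<in> C" "{last xs, a} \<in> C" "a \<noteq> c" "b \<noteq> last xs"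
      using cyc by (auto simp: is_cycle_def xs)
    show False
    proof (cases "rep a = a")
      case True
      then have "rep b \<noteq> b" using nbr'[OF e(1)] by simp
      then have "a = rep b" "c = rep b" using nbr[of b a] nbr[of b c] e by (auto simp: insert_commute)
      then show False using e by simp
    next
      case False
      then have "b = rep a" "last xs = rep a" using nbr[of a b] nbr[of a "last xs"] e by (auto simp: insert_commute)
      then show False using e by simp
    qed
  qed
  have "simple_graph_on V C"
    unfolding simple_graph_on_def C_def using rep RV by blast
  then have cg: "constraint_graph V C" using no_cycle by (simp add: constraint_graph_def)
  let ?E = "{(x, y). {x, y} \<in> C}"
  have E: "?E \<subseteq> R"
    using rep R by (auto simp: C_def doubleton_eq_iff dest: equivE intro: symD[of R])
  have "conn V C = R"
  proof (intro equalityI subrelI)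
    fix a b assume "(a, b) \<in> conn V C"
    then have "a \<in> V" "(a, b) \<in> ?E\<^sup>*" by (auto simp: conn_def)
    from this(2) show "(a, b) \<in> R"
    proof (induction rule: rtrancl_induct)
      case base
      show ?case using R \<open>a \<in> V\<close> by (auto simp: equiv_def refl_on_def)
    next
      case (step y z)
      then show ?case using E R by (meson equivE subsetD transE)
    qed
  next
    fix a b assume ab: "(a, b) \<in> R"
    then have V: "a \<in> V" "b \<in> V" using RV by auto
    have step: "(c, rep c) \<in> ?E\<^sup>*" "(rep c, c) \<in> ?E\<^sup>*" if "c \<in> V" for c
      using that by (cases "rep c = c"; force simp: C_def insert_commute)+
    have "(a, b) \<in> ?E\<^sup>*"
      by (rule rtrancl_trans[OF step(1)[OF V(1)]]) (use step(2)[OF V(2)] rep_eq[OF ab] in simp)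
    then show "(a, b) \<in> conn V C" using V by (simp add: conn_def)
  qed
  then show ?thesis using cg by blast
qed

section \<open>Dominant classes as extremal relations\<close>

definition separated :: "nat \<Rightarrow> nat \<Rightarrow> vertex rel \<Rightarrow> bool" where
  "separated m k R \<longleftrightarrow> (\<forall>P\<in>pieces m k. \<forall>u\<in>P. \<forall>v\<in>P. u \<noteq> v \<longrightarrow> (u, v) \<notin> R)"

definition even_quotient :: "nat \<Rightarrow> nat \<Rightarrow> vertex rel \<Rightarrow> bool" where
  "even_quotient m k R \<longleftrightarrow>
     (\<forall>e. even (count (image_mset (\<lambda>e. (\<lambda>v. R `` {v}) ` e) (H_edges m k)) e))"

text \<open>
  The connectivity relations of the constraint graphs of nonzero value.
\<close>

definition admissible :: "nat \<Rightarrow> nat \<Rightarrow> vertex rel set" where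
  "admissible m k = {R. equiv (H_verts m k) R \<and> separated m k R \<and> even_quotient m k R}"

lemma val_nonzero: "val m k C \<noteq> 0 \<longleftrightarrow> even_quotient m k (conn (H_verts m k) C)"
proof -
  have "(\<forall>e\<in>#M. even (count M e)) \<longleftrightarrow> (\<forall>e. even (count M e))" for M :: "vertex set set multiset"
    by (metis even_zero not_in_iff)
  moreover have "edges (contract (H_Z m k) C) =
    image_mset (\<lambda>e. (\<lambda>v. conn (H_verts m k) C `` {v}) ` e) (H_edges m k)"
    by (simp add: contract_def H_Z_def)
  ultimately show ?thesis unfolding val_def even_quotient_def by (simp only:) simp
qed

lemma CG_conn: "C \<in> CG m k \<longleftrightarrow> constraint_graph (H_verts m k) C \<and> separated m k (conn (H_verts m k) C)"
  by (simp add: CG_def separated_def H_Z_def)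

lemma finite_H_verts: "finite (H_verts m k)"
proof -
  have "H_verts m k = (\<lambda>(i, j). A i j) ` ({1..k} \<times> {1..m}) \<union> (\<lambda>(i, j). B i j) ` ({1..k} \<times> {1..m})"
    by (auto simp: H_verts_def)
  then show ?thesis by simp
qed

lemma card_quotient_by_conn:
  assumes "D \<subseteq> CG m k"
  shows "card (D // equivalent m k) = card (conn (H_verts m k) ` D)"
proof -
  let ?c = "conn (H_verts m k)"
  define f where "f r = {C \<in> CG m k. ?c C = r}" for r
  have img: "equivalent m k `` {C} = f (?c C)" if "C \<in> D" for C
    using that assms by (auto simp: equivalent_def f_def H_Z_def)
  have "D // equivalent m k = f ` ?c ` D"
    unfolding quotient_def using img by auto
  moreover have "inj_on f (?c ` D)"
  proof (rule inj_onI, clarify)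
    fix C C' assume *: "C \<in> D" "C' \<in> D" "f (?c C) = f (?c C')"
    have "C \<in> f (?c C)" using * assms by (auto simp: f_def)
    then have "C \<in> f (?c C')" using * by simp
    then show "?c C = ?c C'" by (simp add: f_def)
  qed
  ultimately show ?thesis by (simp add: card_image)
qed

text \<open>
  Equivalent graphs have the same relation, and the number of edges of a forest is minimal when the
  number of its classes is maximal.
\<close>

lemma card_dominant_classes:
  assumes bound: "\<And>R. R \<in> admissible m k \<Longrightarrow> card (H_verts m k // R) \<le> N"
    and attained: "R0 \<in> admissible m k" "card (H_verts m k // R0) = N"
  shows "card (dominant_classes m k) = card {R \<in> admissible m k. card (H_verts m k // R) = N}"
proof -
  let ?V = "H_verts m k"
  have realize: "\<exists>C. C \<in> CG m k \<and> val m k C \<noteq> 0 \<and> conn ?V C = R" if "R \<in> admissible m k" for R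
  proof -
    have R: "equiv ?V R" "separated m k R" "even_quotient m k R" using that by (auto simp: admissible_def)
    obtain C where C: "constraint_graph ?V C" "conn ?V C = R" using equiv_is_conn[OF R(1)] by blast
    then have "C \<in> CG m k" "val m k C \<noteq> 0" using R(2,3) unfolding CG_conn val_nonzero by simp_all
    then show ?thesis using C(2) by blast
  qed
  have adm: "conn ?V C \<in> admissible m k" if "C \<in> CG m k" "val m k C \<noteq> 0" for C
    using that equiv_conn unfolding admissible_def CG_conn val_nonzero by blast
  have size: "card C + card (?V // conn ?V C) = card ?V" if "C \<in> CG m k" for C
    using card_forest[OF finite_H_verts] that by (simp add: CG_conn)
  have dom: "dominant m k C \<longleftrightarrow> C \<in> CG m k \<and> val m k C \<noteq> 0 \<and> card (?V // conn ?V C) = N" for C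
  proof
    assume C: "dominant m k C"
    then have C': "C \<in> CG m k" "val m k C \<noteq> 0" by (auto simp: dominant_def)
    obtain C0 where C0: "C0 \<in> CG m k" "val m k C0 \<noteq> 0" "conn ?V C0 = R0" using realize[OF attained(1)] by blast
    have "card C \<le> card C0" using C C0 by (auto simp: dominant_def)
    then have "N \<le> card (?V // conn ?V C)" using size[OF C'(1)] size[OF C0(1)] C0(3) attained(2) by simp
    then show "C \<in> CG m k \<and> val m k C \<noteq> 0 \<and> card (?V // conn ?V C) = N"
      using C' bound[OF adm[OF C']] by simp
  next
    assume C: "C \<in> CG m k \<and> val m k C \<noteq> 0 \<and> card (?V // conn ?V C) = N"
    have "card C \<le> card C'" if "C' \<in> CG m k" "val m k C' \<noteq> 0" for C'
      using size[of C] size[OF that(1)] bound[OF adm[OF that]] C by simp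
    then show "dominant m k C" using C by (simp add: dominant_def)
  qed
  have "conn ?V ` {C. dominant m k C} = {R \<in> admissible m k. card (?V // R) = N}"
    using realize adm by (fastforce simp: dom)
  moreover have "{C. dominant m k C} \<subseteq> CG m k" by (auto simp: dominant_def)
  ultimately show ?thesis unfolding dominant_classes_def using card_quotient_by_conn by metis
qed

section \<open>The multigraph as a cyclic sequence of layers\<close>

text \<open>
  Layer \<open>2i\<close> consists of the vertices \<open>a\<^bsub>i+1,j\<^esub>\<close> and layer \<open>2i + 1\<close> of the vertices \<open>b\<^bsub>i+1,j\<^esub>\<close>; the shift
  by one comes from numbering the layers from 0.
\<close>

definition vertex_at :: "nat \<Rightarrow> nat \<Rightarrow> nat \<Rightarrow> vertex" where
  "vertex_at k t j = (if even t then A (t div 2 mod k + 1) j else B (t div 2 mod k + 1) j)"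

lemma vertex_at_mult: "vertex_at k (t + n * (2 * k)) j = vertex_at k t j"
proof -
  have "(t + n * (2 * k)) div 2 = t div 2 + n * k"
    using div_mult_self1[of 2 t "n * k"] by (simp add: mult.left_commute)
  then show ?thesis by (simp add: vertex_at_def)
qed

lemma vertex_at_mod: "t mod (2 * k) = t' mod (2 * k) \<Longrightarrow> vertex_at k t j = vertex_at k t' j"
  by (metis mod_div_mult_eq vertex_at_mult)

lemma vertex_at_simps:
  "i < k \<Longrightarrow> vertex_at k (2 * i) j = A (Suc i) j"
  "i < k \<Longrightarrow> vertex_at k (Suc (2 * i)) j = B (Suc i) j"
  "i < k \<Longrightarrow> vertex_at k (Suc (Suc (2 * i))) j = A (cyc_next k (Suc i)) j"
  by (auto simp: vertex_at_def cyc_next_def)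

lemma H_verts_vertex_at:
  assumes "k \<ge> 1"
  shows "H_verts m k = {vertex_at k t j | t j. j \<in> {1..m}}"
proof (intro equalityI subsetI)
  fix v assume "v \<in> H_verts m k"
  then obtain i j where ij: "i < k" "j \<in> {1..m}" "v = A (Suc i) j \<or> v = B (Suc i) j"
    by (auto simp: H_verts_def) (metis Suc_le_D)+
  then have "v = vertex_at k (2 * i) j \<or> v = vertex_at k (Suc (2 * i)) j"
    by (simp add: vertex_at_simps)
  then show "v \<in> {vertex_at k t j | t j. j \<in> {1..m}}" using ij(2) by blast
next
  fix v assume "v \<in> {vertex_at k t j | t j. j \<in> {1..m}}"
  then show "v \<in> H_verts m k"
    using assms by (auto simp: vertex_at_def H_verts_def Suc_le_eq split: if_splits)
qed

lemma adjacent_layers_in_piece: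
  assumes "k \<ge> 1"
  shows "\<exists>P\<in>pieces m k. \<forall>j\<in>{1..m}. vertex_at k t j \<in> P \<and> vertex_at k (Suc t) j \<in> P"
proof -
  define i where "i = t div 2 mod k"
  have i: "i < k" using assms by (simp add: i_def)
  have mod: "t mod (2 * k) = (2 * i + t mod 2) mod (2 * k)"
    by (metis i_def mod_mod_trivial mod_mult2_eq)
  have mod': "Suc t mod (2 * k) = Suc (2 * i + t mod 2) mod (2 * k)"
    using mod by (metis mod_Suc)
  have eq: "vertex_at k t j = vertex_at k (2 * i + t mod 2) j"
    "vertex_at k (Suc t) j = vertex_at k (Suc (2 * i + t mod 2)) j" for j
    using mod mod' by (auto intro: vertex_at_mod)
  show ?thesis
  proof (cases "even t")
    case True
    then have "{A (Suc i) j | j. j \<in> {1..m}} \<union> {B (Suc i) j | j. j \<in> {1..m}} \<in> pieces m k"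
      using i by (force simp: pieces_def)
    then show ?thesis
      by (rule bexI[rotated]) (use True i in \<open>auto simp: eq vertex_at_simps\<close>)
  next
    case False
    then have "{B (Suc i) j | j. j \<in> {1..m}} \<union> {A (cyc_next k (Suc i)) j | j. j \<in> {1..m}} \<in> pieces m k"
      using i by (force simp: pieces_def)
    then show ?thesis
      by (rule bexI[rotated]) (use False i in \<open>auto simp: eq vertex_at_simps odd_iff_mod_2_eq_one\<close>)
  qed
qed

text \<open>
  The positions of the edges. Parallel edges, such as those for \<open>k = 1\<close>, have different positions,
  so that multiplicities become cardinalities of sets of positions.
\<close>

definition slots :: "nat \<Rightarrow> nat \<Rightarrow> (nat \<times> nat \<times> nat) set" where
  "slots m k = (SIGMA t:{..<2 * k}. {(p, q). p \<in> {1..m} \<and> q \<in> {1..m} \<and> adj t p q})"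

lemma finite_slots: "finite (slots m k)"
  by (rule finite_subset[of _ "{..<2 * k} \<times> {1..m} \<times> {1..m}"]) (auto simp: slots_def)

lemma sum_slots:
  fixes F :: "nat \<Rightarrow> nat \<Rightarrow> nat \<Rightarrow> 'a :: comm_monoid_add"
  shows "(\<Sum>(t, p, q)\<in>slots m k. F t p q) = (\<Sum>i<k.
    (\<Sum>j\<in>{1..m}. F (2 * i) j j + F (Suc (2 * i)) j j) +
    (\<Sum>j\<in>{1..<m}. F (2 * i) (Suc j) j + F (Suc (2 * i)) j (Suc j)))"
proof -
  have pairs: "(\<Sum>(p, q)\<in>{(p, q). p \<in> {1..m} \<and> q \<in> {1..m} \<and> adj t p q}. F t p q) =
    (\<Sum>j\<in>{1..m}. F t j j) + (\<Sum>j\<in>{1..<m}. if even t then F t (Suc j) j else F t j (Suc j))" for t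
  proof -
    define h where "h j = (if even t then (Suc j, j) else (j, Suc j))" for j
    have "{(p, q). p \<in> {1..m} \<and> q \<in> {1..m} \<and> adj t p q} = (\<lambda>j. (j, j)) ` {1..m} \<union> h ` {1..<m}"
      by (auto simp: adj_def h_def)
    moreover have "(\<lambda>j. (j, j)) ` {1..m} \<inter> h ` {1..<m} = {}" by (auto simp: h_def split: if_splits)
    moreover have "inj_on h {1..<m}" "inj_on (\<lambda>j. (j, j)) {1..m}" by (auto simp: inj_on_def h_def)
    ultimately have "(\<Sum>(p, q)\<in>{(p, q). p \<in> {1..m} \<and> q \<in> {1..m} \<and> adj t p q}. F t p q) =
      (\<Sum>j\<in>{1..m}. F t j j) + (\<Sum>j\<in>{1..<m}. case h j of (p, q) \<Rightarrow> F t p q)"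
      by (simp only: sum.union_disjoint finite_imageI finite_atLeastAtMost finite_atLeastLessThan
          sum.reindex o_def case_prod_conv)
    then show ?thesis by (auto simp: h_def if_distrib intro!: sum.cong cong: if_cong)
  qed
  have halves: "(\<Sum>t<2 * k. G t) = (\<Sum>i<k. G (2 * i) + G (Suc (2 * i)))" for G :: "nat \<Rightarrow> 'a"
    by (induction k) (simp_all add: add.assoc)
  have "(\<Sum>(t, p, q)\<in>slots m k. F t p q) = (\<Sum>t<2 * k.
      \<Sum>(p, q)\<in>{(p, q). p \<in> {1..m} \<and> q \<in> {1..m} \<and> adj t p q}. F t p q)"
    unfolding slots_def
    by (subst sum.Sigma) (auto intro: finite_subset[of _ "{1..m} \<times> {1..m}"] intro!: sum.cong)
  then show ?thesis
    unfolding halves pairs by (simp add: sum.distrib ac_simps)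
qed

lemma H_edges_slots:
  assumes "k \<ge> 1"
  shows "H_edges m k = image_mset (\<lambda>(t, p, q). {vertex_at k t p, vertex_at k (Suc t) q}) (mset_set (slots m k))"
proof -
  have "image_mset f (mset_set S) = (\<Sum>s\<in>S. {#f s#})" if "finite S" for f :: "nat \<times> nat \<times> nat \<Rightarrow> vertex set" and S
    using that by (induction S rule: finite_induct) auto
  from this[OF finite_slots, of "\<lambda>(t, p, q). {vertex_at k t p, vertex_at k (Suc t) q}" m k]
  have "image_mset (\<lambda>(t, p, q). {vertex_at k t p, vertex_at k (Suc t) q}) (mset_set (slots m k)) =
    (\<Sum>(t, p, q)\<in>slots m k. {#{vertex_at k t p, vertex_at k (Suc t) q}#})"
    by (simp add: case_prod_unfold)
  also have "\<dots> = (\<Sum>i<k. (\<Sum>j\<in>{1..m}. {#{A (Suc i) j, B (Suc i) j}, {B (Suc i) j, A (cyc_next k (Suc i)) j}#}) +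
      (\<Sum>j\<in>{1..<m}. {#{A (Suc i) (j + 1), B (Suc i) j}, {B (Suc i) j, A (cyc_next k (Suc i)) (j + 1)}#}))"
    unfolding sum_slots by (intro sum.cong refl arg_cong2[of _ _ _ _ "(+)"]) (auto simp: vertex_at_simps)
  also have "\<dots> = H_edges m k"
    unfolding H_edges_def
    by (rule sum.reindex_bij_witness[of _ "\<lambda>i. i - 1" Suc]) auto
  finally show ?thesis by simp
qed

definition class_at :: "nat \<Rightarrow> vertex rel \<Rightarrow> nat \<Rightarrow> nat \<Rightarrow> vertex set" where
  "class_at k R t j = R `` {vertex_at k t j}"

lemma count_image_mset_set:
  assumes "finite S"
  shows "count (image_mset h (mset_set S)) e = card {s \<in> S. h s = e}"
  using assms
proof (induction S rule: finite_induct)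
  case (insert a S)
  have "{s \<in> insert a S. h s = e} = (if h a = e then insert a {s \<in> S. h s = e} else {s \<in> S. h s = e})"
    by auto
  then show ?case using insert by simp
qed simp

lemma even_quotient_slots:
  assumes "k \<ge> 1"
  shows "even_quotient m k R \<longleftrightarrow>
    (\<forall>e. even (card {(t, p, q) \<in> slots m k. {class_at k R t p, class_at k R (Suc t) q} = e}))"
proof -
  have "count (image_mset (\<lambda>e. (\<lambda>v. R `` {v}) ` e) (H_edges m k)) e =
    card {(t, p, q) \<in> slots m k. {class_at k R t p, class_at k R (Suc t) q} = e}" for e
  proof -
    have "image_mset (\<lambda>e. (\<lambda>v. R `` {v}) ` e) (H_edges m k) =
      image_mset (\<lambda>(t, p, q). {class_at k R t p, class_at k R (Suc t) q}) (mset_set (slots m k))"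
      unfolding H_edges_slots[OF assms] multiset.map_comp
      by (rule image_mset_cong) (auto simp: class_at_def)
    also have "count \<dots> e = card {s \<in> slots m k. (case s of (t, p, q) \<Rightarrow> {class_at k R t p, class_at k R (Suc t) q}) = e}"
      using finite_slots by (rule count_image_mset_set)
    finally show ?thesis by (simp add: case_prod_unfold)
  qed
  then show ?thesis by (simp add: even_quotient_def)
qed

lemma class_at_mod: "t mod (2 * k) = t' mod (2 * k) \<Longrightarrow> class_at k R t j = class_at k R t' j"
  unfolding class_at_def by (simp only: vertex_at_mod[of t k t'])

lemma class_at_eq_iff:
  assumes "equiv (H_verts m k) R" "k \<ge> 1" "j \<in> {1..m}" "j' \<in> {1..m}"
  shows "class_at k R t j = class_at k R t' j' \<longleftrightarrow> (vertex_at k t j, vertex_at k t' j') \<in> R"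
  unfolding class_at_def
  by (rule eq_equiv_class_iff[OF assms(1)]) (use assms in \<open>auto simp: H_verts_vertex_at\<close>)

text \<open>
  The classes of an admissible relation form a labelling of the layers. As the number of positions of
  an edge is even, the position of a step is not its only one.
\<close>

lemma layered_walks_class_at:
  assumes R: "R \<in> admissible m k" and k: "k \<ge> 1"
  shows "layered_walks m k (class_at k R)"
proof
  note eq = class_at_eq_iff[of m k R, OF _ k]
  have R': "equiv (H_verts m k) R" "separated m k R" "even_quotient m k R" using R by (auto simp: admissible_def)
  show "1 \<le> k" by (rule k)
  show "class_at k R (t + 2 * k) j = class_at k R t j" for t j by (rule class_at_mod) simp
  show inj: "j = j'" if "j \<in> {1..m}" "j' \<in> {1..m}" "class_at k R t j = class_at k R t j'" for t j j'
  proof (rule ccontr)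
    assume "j \<noteq> j'"
    then have "vertex_at k t j \<noteq> vertex_at k t j'" by (auto simp: vertex_at_def)
    then have "(vertex_at k t j, vertex_at k t j') \<notin> R"
      using R'(2) adjacent_layers_in_piece[OF k, of m t] that by (auto simp: separated_def)
    then show False using that eq[OF R'(1)] by blast
  qed
  show adj: "class_at k R t j \<noteq> class_at k R (Suc t) j'" if "j \<in> {1..m}" "j' \<in> {1..m}" for t j j'
  proof
    assume "class_at k R t j = class_at k R (Suc t) j'"
    moreover have "vertex_at k t j \<noteq> vertex_at k (Suc t) j'" by (auto simp: vertex_at_def)
    then have "(vertex_at k t j, vertex_at k (Suc t) j') \<notin> R"
      using R'(2) adjacent_layers_in_piece[OF k, of m t] that by (auto simp: separated_def)
    ultimately show False using that eq[OF R'(1)] by blast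
  qed
  show "\<exists>t' p q. t' mod (2 * k) \<noteq> t mod (2 * k) \<and> p \<in> {1..m} \<and> q \<in> {1..m} \<and> adj t' p q \<and>
      {class_at k R t j, class_at k R (Suc t) j} = {class_at k R t' p, class_at k R (Suc t') q}"
    if j: "j \<in> {1..m}" for t j
  proof -
    define r where "r = t mod (2 * k)"
    define E where "E = {(t', p, q) \<in> slots m k. {class_at k R t' p, class_at k R (Suc t') q} =
      {class_at k R t j, class_at k R (Suc t) j}}"
    have r: "r < 2 * k" "r mod (2 * k) = t mod (2 * k)" "Suc r mod (2 * k) = Suc t mod (2 * k)"
      using k by (auto simp: r_def mod_Suc)
    have cl: "class_at k R r p = class_at k R t p" "class_at k R (Suc r) p = class_at k R (Suc t) p" for p
      by (rule class_at_mod[OF r(2)], rule class_at_mod[OF r(3)])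
    have "even (card E)"
      using R'(3) unfolding even_quotient_slots[OF k] E_def by blast
    moreover have "(r, j, j) \<in> E" using j r(1) unfolding E_def by (simp add: slots_def cl adj_def)
    moreover have "finite E" using finite_slots by (auto simp: E_def intro: rev_finite_subset)
    ultimately have "\<exists>s\<in>E. s \<noteq> (r, j, j)"
      by (metis card_1_singleton_iff is_singletonI' is_singleton_altdef odd_one empty_iff)
    then obtain t' p q where s: "(t', p, q) \<in> E" "(t', p, q) \<noteq> (r, j, j)" by auto
    then have s': "t' < 2 * k" "p \<in> {1..m}" "q \<in> {1..m}" "adj t' p q"
      "{class_at k R t j, class_at k R (Suc t) j} = {class_at k R t' p, class_at k R (Suc t') q}"
      by (auto simp: E_def slots_def)
    have "t' \<noteq> r"
    proof
      assume "t' = r"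
      then have "{class_at k R t j, class_at k R (Suc t) j} = {class_at k R t p, class_at k R (Suc t) q}"
        using s'(5) cl by simp
      then have "class_at k R t j = class_at k R t p" "class_at k R (Suc t) j = class_at k R (Suc t) q"
        using adj[OF j s'(3), of t] adj[OF s'(2) j, of t] by (auto simp: doubleton_eq_iff)
      then have "j = p" "j = q" using inj j s'(2,3) by blast+
      then show False using s \<open>t' = r\<close> by simp
    qed
    then have "t' mod (2 * k) \<noteq> t mod (2 * k)" using s'(1) by (simp add: r_def)
    then show ?thesis using s' by blast
  qed
qed

lemma labels_class_at:
  assumes R: "R \<in> admissible m k" and k: "k \<ge> 1"
  shows "layered_walks.labels m (class_at k R) = H_verts m k // R"
proof -
  interpret layered_walks m k "class_at k R" by (rule layered_walks_class_at[OF assms])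
  show ?thesis
  proof (intro equalityI subsetI)
    fix X assume "X \<in> labels"
    then obtain t j where "j \<in> {1..m}" "X = class_at k R t j" by (auto simp: labels_def layer_def)
    then show "X \<in> H_verts m k // R"
      unfolding class_at_def by (auto simp: H_verts_vertex_at[OF k] intro!: quotientI)
  next
    fix X assume "X \<in> H_verts m k // R"
    then obtain v where "v \<in> H_verts m k" "X = R `` {v}" by (rule quotientE)
    then obtain t j where "j \<in> {1..m}" "X = class_at k R t j"
      by (auto simp: H_verts_vertex_at[OF k] class_at_def)
    then show "X \<in> labels" using in_labels by simp
  qed
qed

lemma card_classes_le:
  assumes "R \<in> admissible m k" "k \<ge> 1"
  shows "card (H_verts m k // R) \<le> m * (k + 1)"
  using layered_walks.card_labels_le[OF layered_walks_class_at[OF assms]] labels_class_at[OF assms] by simp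

section \<open>The complement of a noncrossing partition\<close>

text \<open>
  A noncrossing partition of the points below \<open>k\<close>, given by the least elements of its blocks.
\<close>

locale noncrossing_minimum =
  fixes k :: nat and f :: "nat \<Rightarrow> nat"
  assumes below: "y < k \<Longrightarrow> f y \<le> y"
    and nested: "y < k \<Longrightarrow> f y \<le> z \<Longrightarrow> z \<le> y \<Longrightarrow> f y \<le> f z"
begin

lemma idem: "y < k \<Longrightarrow> f (f y) = f y"
  using below[of y] below[of "f y"] nested[of y "f y"] by (simp add: order_antisym)

definition last_in_block :: "nat \<Rightarrow> bool" where
  "last_in_block i \<longleftrightarrow> (\<forall>u. i < u \<and> u < k \<longrightarrow> f u \<noteq> f i)"

text \<open>
  The next element of the block in cyclic order.
\<close>

definition cyc_succ :: "nat \<Rightarrow> nat" where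
  "cyc_succ i = (if last_in_block i then f i else (LEAST u. i < u \<and> u < k \<and> f u = f i))"

lemma cyc_succ_not_last:
  assumes "\<not> last_in_block i"
  shows "i < cyc_succ i" "cyc_succ i < k" "f (cyc_succ i) = f i"
    "i < u \<Longrightarrow> u < cyc_succ i \<Longrightarrow> f u \<noteq> f i"
    "i < u \<Longrightarrow> u < k \<Longrightarrow> f u = f i \<Longrightarrow> cyc_succ i \<le> u"
proof -
  let ?P = "\<lambda>u. i < u \<and> u < k \<and> f u = f i"
  have ex: "\<exists>u. ?P u" using assms by (auto simp: last_in_block_def)
  have L: "?P (cyc_succ i)" using LeastI_ex[OF ex] assms by (simp add: cyc_succ_def)
  then show "i < cyc_succ i" "cyc_succ i < k" "f (cyc_succ i) = f i" by auto
  show "i < u \<Longrightarrow> u < cyc_succ i \<Longrightarrow> f u \<noteq> f i"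
    using not_less_Least[of u ?P] assms L by (auto simp: cyc_succ_def)
  show "i < u \<Longrightarrow> u < k \<Longrightarrow> f u = f i \<Longrightarrow> cyc_succ i \<le> u"
    using Least_le[of ?P u] assms by (simp add: cyc_succ_def)
qed

lemma cyc_succ_less: "i < k \<Longrightarrow> cyc_succ i < k"
  using cyc_succ_not_last(2)[of i] below[of i] by (cases "last_in_block i") (auto simp: cyc_succ_def)

lemma f_cyc_succ: "i < k \<Longrightarrow> f (cyc_succ i) = f i"
  using cyc_succ_not_last(3)[of i] idem[of i] by (cases "last_in_block i") (auto simp: cyc_succ_def)

lemma cyc_succ_inj:
  assumes "i < k" "i' < k" "cyc_succ i = cyc_succ i'"
  shows "i = i'"
proof -
  have False if *: "i < i'" "i' < k" "cyc_succ i = cyc_succ i'" for i i'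
  proof -
    have i: "i < k" using * by simp
    have "f i' = f i" using f_cyc_succ[OF i] f_cyc_succ[OF *(2)] *(3) by simp
    then have nl: "\<not> last_in_block i" and le: "cyc_succ i \<le> i'"
      using * cyc_succ_not_last(5)[of i i'] by (auto simp: last_in_block_def)
    show False
    proof (cases "last_in_block i'")
      case True
      then have "cyc_succ i' = f i" using \<open>f i' = f i\<close> by (simp add: cyc_succ_def)
      then show False using below[OF i] cyc_succ_not_last(1)[OF nl] *(3) by simp
    next
      case False
      then show False using cyc_succ_not_last(1)[OF False] le *(3) by simp
    qed
  qed
  then show ?thesis using assms by (metis linorder_neqE_nat)
qed

text \<open>
  The interval from the least to the greatest element of a block is a union of blocks.
\<close>

lemma cut_before_min:
  assumes i: "i < k" "last_in_block i" and f0: "f i \<noteq> 0"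
  shows "cut k f (f i - 1) = cut k f i"
proof (rule iffD2[OF cut_eq_iff])
  show "f i - 1 \<le> i" using below[OF i(1)] by simp
  show "i < k" by (rule i(1))
  show "\<forall>s\<in>{f i - 1<..i}. \<forall>u<k. f u = f s \<longrightarrow> u \<in> {f i - 1<..i}"
  proof (intro ballI allI impI)
    fix s u assume *: "s \<in> {f i - 1<..i}" "u < k" "f u = f s"
    have s: "f i \<le> s" "s \<le> i" "s < k" using * i f0 by auto
    have fs: "f i \<le> f s" using nested[OF i(1) s(1,2)] .
    have "f i \<le> u" using fs below[OF *(2)] *(3) by simp
    moreover have "u \<le> i"
    proof (rule ccontr)
      assume "\<not> u \<le> i"
      then have "f u \<le> f i" using nested[OF *(2), of i] *(3) below[OF s(3)] s(2) by simp
      then have "f u = f i" using fs *(3) by simp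
      then show False using i(2) \<open>\<not> u \<le> i\<close> *(2) by (auto simp: last_in_block_def)
    qed
    ultimately show "u \<in> {f i - 1<..i}" using f0 by auto
  qed
qed

text \<open>
  The points strictly between two consecutive elements of a block form a union of blocks.
\<close>

lemma cut_before_succ:
  assumes i: "i < k" "\<not> last_in_block i"
  shows "cut k f i = cut k f (cyc_succ i - 1)"
proof (rule iffD2[OF cut_eq_iff])
  define v where "v = cyc_succ i"
  note v = cyc_succ_not_last[OF i(2), folded v_def]
  show "i \<le> cyc_succ i - 1" "cyc_succ i - 1 < k" using v unfolding v_def by auto
  show "\<forall>s\<in>{i<..cyc_succ i - 1}. \<forall>u<k. f u = f s \<longrightarrow> u \<in> {i<..cyc_succ i - 1}"
    unfolding v_def[symmetric]
  proof (intro ballI allI impI)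
    fix s u assume *: "s \<in> {i<..v - 1}" "u < k" "f u = f s"
    have s: "i < s" "s < v" "s < k" using * v by auto
    have "f v \<le> f s" using nested[OF v(2), of s] v(3) below[OF i(1)] s by simp
    then have fs: "f i < f s" using v(3) v(4)[OF s(1,2)] by simp
    have "i < u"
    proof (rule ccontr)
      assume "\<not> i < u"
      then have "f s \<le> i" using below[OF *(2)] *(3) by simp
      then have "f s \<le> f i" using nested[OF s(3), of i] s by simp
      then show False using fs by simp
    qed
    moreover have "u < v"
    proof (rule ccontr)
      assume "\<not> u < v"
      moreover have "f u \<le> v" using *(3) below[OF s(3)] s by simp
      ultimately have "f u \<le> f v" using nested[OF *(2), of v] by simp
      then show False using fs *(3) v(3) by simp
    qed
    ultimately show "u \<in> {i<..v - 1}" by auto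
  qed
qed

text \<open>
  Send \<open>i\<close> to the gap just before the cyclic successor of \<open>i\<close> in its block. In the closed walk this
  pairs the step from \<open>a\<^sub>i\<close> to \<open>b\<^sub>i\<close> with a step between the same two classes in the opposite direction,
  which is why all multiplicities are even.
\<close>

lemma exists_turning_permutation:
  "\<exists>\<sigma>. bij_betw \<sigma> {..<k} {..<k} \<and>
    (\<forall>i<k. f ((\<sigma> i + 1) mod k) = f i \<and> cut k f (\<sigma> i) = cut k f i)"
proof -
  define \<sigma> where "\<sigma> i = (cyc_succ i + (k - 1)) mod k" for i
  have succ: "(\<sigma> i + 1) mod k = cyc_succ i" if "i < k" for i
  proof -
    have "(\<sigma> i + 1) mod k = (cyc_succ i + (k - 1) + 1) mod k" unfolding \<sigma>_def by (rule mod_add_left_eq)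
    also have "cyc_succ i + (k - 1) + 1 = cyc_succ i + k" using that by simp
    finally show ?thesis using cyc_succ_less[OF that] by simp
  qed
  have pred: "\<sigma> i = (if cyc_succ i = 0 then k - 1 else cyc_succ i - 1)" if "i < k" for i
  proof (cases "cyc_succ i")
    case (Suc c)
    then have "cyc_succ i + (k - 1) = c + k" using that by simp
    then have "\<sigma> i = (c + k) mod k" by (simp only: \<sigma>_def)
    then show ?thesis using Suc cyc_succ_less[OF that] by simp
  qed (use that in \<open>simp add: \<sigma>_def\<close>)
  have "inj_on \<sigma> {..<k}"
    by (rule inj_onI) (metis succ cyc_succ_inj lessThan_iff)
  moreover have "\<sigma> ` {..<k} \<subseteq> {..<k}" by (auto simp: \<sigma>_def)
  ultimately have "bij_betw \<sigma> {..<k} {..<k}" by (simp add: bij_betw_def endo_inj_surj)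
  moreover have "cut k f (\<sigma> i) = cut k f i" if i: "i < k" for i
  proof (cases "last_in_block i")
    case False
    then show ?thesis
      using cut_before_succ[OF i False] cyc_succ_not_last(1)[OF False] pred[OF i] by simp
  next
    case last: True
    then have s: "cyc_succ i = f i" by (simp add: cyc_succ_def)
    show ?thesis
    proof (cases "f i = 0")
      case False
      then show ?thesis using cut_before_min[OF i last] pred[OF i] s by simp
    next
      case True
      have "cut k f i = {}"
      proof (rule ccontr)
        assume "cut k f i \<noteq> {}"
        then obtain a u where au: "a \<le> i" "i < u" "u < k" "f a = f u" by (auto simp: cut_def)
        have "f u \<le> i" using au below[of a] by simp
        then have "f u = f i" using nested[OF au(3), of i] au True by simp
        then show False using last au by (auto simp: last_in_block_def)
      qed
      moreover have "cut k f (k - 1) = {}" by (auto simp: cut_def)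
      ultimately show ?thesis using pred[OF i] s True by simp
    qed
  qed
  ultimately show ?thesis using f_cyc_succ succ by metis
qed

text \<open>
  A gap \<open>i\<close> is not the first one of its class exactly if \<open>i\<close> is the greatest element of a block not
  containing 0. There is one block containing 0, and hence the two numbers of classes add up to \<open>k + 1\<close>.
\<close>

lemma card_blocks_complement:
  assumes k: "k \<ge> 1"
  shows "card (f ` {..<k}) + card (cut k f ` {..<k}) = k + 1"
proof -
  define L where "L = {i \<in> {..<k}. last_in_block i}"
  define F where "F = {i \<in> {..<k}. \<forall>i'<i. cut k f i' \<noteq> cut k f i}"
  have inj_L: "inj_on f L"
  proof (rule inj_onI)
    fix i i' assume "i \<in> L" "i' \<in> L" "f i = f i'"
    then show "i = i'" by (cases i i' rule: linorder_cases) (auto simp: L_def last_in_block_def)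
  qed
  have img_L: "f ` L = f ` {..<k}"
  proof
    show "f ` {..<k} \<subseteq> f ` L"
    proof clarify
      fix y assume y: "y < k"
      define T where "T = {i. i < k \<and> f i = f y}"
      have T: "finite T" "y \<in> T" using y by (auto simp: T_def)
      then have mem: "Max T \<in> T" by (intro Max_in) auto
      have "last_in_block (Max T)"
        unfolding last_in_block_def
      proof (intro allI impI notI)
        fix u assume u: "Max T < u \<and> u < k" "f u = f (Max T)"
        then have "u \<in> T" using mem by (simp add: T_def)
        then show False using Max_ge[OF T(1), of u] u by simp
      qed
      then have "Max T \<in> L" "f (Max T) = f y" using mem by (auto simp: L_def T_def)
      then show "f y \<in> f ` L" by (metis imageI)
    qed
  qed (auto simp: L_def)
  have "bij_betw (cut k f) F (cut k f ` {..<k})"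
    unfolding bij_betw_def
  proof
    show "inj_on (cut k f) F"
    proof (rule inj_onI)
      fix i i' assume "i \<in> F" "i' \<in> F" "cut k f i = cut k f i'"
      then show "i = i'" by (cases i i' rule: linorder_cases) (auto simp: F_def)
    qed
    show "cut k f ` F = cut k f ` {..<k}"
    proof
      show "cut k f ` {..<k} \<subseteq> cut k f ` F"
      proof clarify
        fix y assume y: "y < k"
        define a where "a = (LEAST i. cut k f i = cut k f y)"
        have a: "cut k f a = cut k f y" unfolding a_def by (rule LeastI[of _ y]) simp
        have "a \<le> y" unfolding a_def by (rule Least_le) simp
        moreover have "cut k f i' \<noteq> cut k f y" if "i' < a" for i'
          using not_less_Least[of i' "\<lambda>i. cut k f i = cut k f y"] that by (simp add: a_def)
        ultimately have "a \<in> F" using y a by (simp add: F_def)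
        then show "cut k f y \<in> cut k f ` F" using a by (metis imageI)
      qed
    qed (auto simp: F_def)
  qed
  then have card_F: "card F = card (cut k f ` {..<k})" by (rule bij_betw_same_card)
  have F_iff: "i \<in> F \<longleftrightarrow> \<not> (last_in_block i \<and> f i \<noteq> 0)" if i: "i < k" for i
  proof
    assume "i \<in> F"
    then show "\<not> (last_in_block i \<and> f i \<noteq> 0)"
      using cut_before_min[OF i] below[OF i] by (auto simp: F_def)
  next
    assume nl: "\<not> (last_in_block i \<and> f i \<noteq> 0)"
    show "i \<in> F"
    proof (rule ccontr)
      assume "i \<notin> F"
      then obtain i' where i': "i' < i" "cut k f i' = cut k f i" using i by (auto simp: F_def)
      have "\<forall>s\<in>{i'<..i}. \<forall>u<k. f u = f s \<longrightarrow> u \<in> {i'<..i}"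
        by (rule iffD1[OF cut_eq_iff]) (use i' i in simp_all)
      then have sat: "u \<in> {i'<..i}" if "s \<in> {i'<..i}" "u < k" "f u = f s" for s u
        using that by blast
      have "f i \<in> {i'<..i}" using sat[of i "f i"] i' i idem[OF i] below[OF i] by simp
      moreover have "last_in_block i"
        unfolding last_in_block_def
      proof (intro allI impI notI)
        fix u assume u: "i < u \<and> u < k" "f u = f i"
        then have "u \<in> {i'<..i}" using sat[of i u] i' by simp
        then show False using u by simp
      qed
      ultimately show False using nl by simp
    qed
  qed
  define L' where "L' = {i \<in> L. f i \<noteq> 0}"
  have "f ` L' = f ` {..<k} - {0}" unfolding img_L[symmetric] by (auto simp: L'_def)
  moreover have "card (f ` L') = card L'"
    by (rule card_image) (rule inj_on_subset[OF inj_L], auto simp: L'_def)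
  moreover have "0 \<in> f ` {..<k}" using below[of 0] k by (intro image_eqI[of _ _ 0]) auto
  ultimately have "card L' = card (f ` {..<k}) - 1" "card (f ` {..<k}) \<noteq> 0" by (auto simp: card_Diff_singleton)
  moreover have "k = card F + card L'"
  proof -
    have "F \<subseteq> {..<k}" "L' \<subseteq> {..<k}" by (auto simp: F_def L'_def L_def)
    moreover have "i \<in> F \<longleftrightarrow> i \<notin> L'" if "i < k" for i
      using F_iff[OF that] that by (simp add: L'_def L_def)
    ultimately have "F = {..<k} - L'" by blast
    moreover have "card L' \<le> k" using card_mono[OF finite_lessThan \<open>L' \<subseteq> {..<k}\<close>] by simp
    ultimately show ?thesis
      using card_Diff_subset[OF finite_subset[OF \<open>L' \<subseteq> {..<k}\<close>] \<open>L' \<subseteq> {..<k}\<close>] by simp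
  qed
  ultimately show ?thesis using card_F by linarith
qed

end

section \<open>Extremal relations and multichains\<close>

text \<open>
  The classes of the relation that belongs to a multichain \<open>b\<close>: walks and kinds of layers are kept apart,
  the \<open>a\<close>-vertices of walk \<open>j\<close> are classified by the blocks of \<open>b j\<close> and the \<open>b\<close>-vertices by its
  complement. The singleton, with an arbitrary second entry 0, merely brings both kinds to one type.
\<close>

definition colour :: "nat \<Rightarrow> (nat \<Rightarrow> nat \<Rightarrow> nat) \<Rightarrow> vertex \<Rightarrow> bool \<times> nat \<times> (nat \<times> nat) set" where
  "colour k b v = (case v of A i j \<Rightarrow> (True, j, {(b j (i - 1), 0)}) | B i j \<Rightarrow> (False, j, cut k (b j) (i - 1)))"

definition partition_of :: "nat \<Rightarrow> nat \<Rightarrow> (nat \<Rightarrow> nat \<Rightarrow> nat) \<Rightarrow> vertex rel" where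
  "partition_of m k b = {(v, w) \<in> H_verts m k \<times> H_verts m k. colour k b v = colour k b w}"

definition chain_of :: "nat \<Rightarrow> nat \<Rightarrow> vertex rel \<Rightarrow> nat \<Rightarrow> nat \<Rightarrow> nat" where
  "chain_of m k R i y = (if i \<in> {1..m} \<and> y < k
     then (LEAST z. class_at k R (2 * z) i = class_at k R (2 * y) i) else 0)"

definition extremal :: "nat \<Rightarrow> nat \<Rightarrow> vertex rel set" where
  "extremal m k = {R \<in> admissible m k. card (H_verts m k // R) = m * (k + 1)}"

lemma tight_walks_class_at:
  assumes "R \<in> extremal m k" "k \<ge> 1"
  shows "tight_walks m k (class_at k R)"
proof -
  have R: "R \<in> admissible m k" "card (H_verts m k // R) = m * (k + 1)"
    using assms by (auto simp: extremal_def)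
  interpret layered_walks m k "class_at k R" by (rule layered_walks_class_at[OF R(1) assms(2)])
  show ?thesis by unfold_locales (simp add: labels_class_at[OF R(1) assms(2)] R(2))
qed

text \<open>
  No other edges of the quotient join an \<open>a\<close>-class of walk \<open>j + 1\<close> and a \<open>b\<close>-class of walk \<open>j\<close>, because
  a class determines its walk and the kind of its layers.
\<close>

lemma connecting_even:
  assumes R: "R \<in> extremal m k" and k: "k \<ge> 1" and j: "j \<in> {1..m}" "Suc j \<in> {1..m}"
  shows "even (card {l. l < k \<and> class_at k R (2 * l) (Suc j) = \<alpha> \<and> class_at k R (2 * l + 1) j = \<beta>} +
    card {l. l < k \<and> class_at k R (2 * l + 2) (Suc j) = \<alpha> \<and> class_at k R (2 * l + 1) j = \<beta>})"
proof -
  interpret tight_walks m k "class_at k R" by (rule tight_walks_class_at[OF R k])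
  let ?x = "class_at k R"
  define L1 where "L1 = {l. l < k \<and> ?x (2 * l) (Suc j) = \<alpha> \<and> ?x (2 * l + 1) j = \<beta>}"
  define L2 where "L2 = {l. l < k \<and> ?x (2 * l + 2) (Suc j) = \<alpha> \<and> ?x (2 * l + 1) j = \<beta>}"
  define E where "E = {(t, p, q) \<in> slots m k. {?x t p, ?x (Suc t) q} = {\<alpha>, \<beta>}}"
  have fin: "finite L1" "finite L2" by (auto simp: L1_def L2_def)
  have "even (card L1 + card L2)"
  proof (cases "L1 = {} \<and> L2 = {}")
    case False
    then obtain a b where a: "\<alpha> = ?x (2 * a) (Suc j)" and b: "\<beta> = ?x (2 * b + 1) j"
    proof (cases "L1 = {}")
      case True
      then obtain l where "l \<in> L2" using False by auto
      then show ?thesis using that[of "l + 1" l] by (simp add: L2_def)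
    next
      case False
      then obtain l where "l \<in> L1" by auto
      then show ?thesis using that[of l l] by (simp add: L1_def)
    qed
    have is_\<alpha>: "p = Suc j" "even t" if "?x t p = \<alpha>" "p \<in> {1..m}" for t p
      using label_determines_walk[OF that(2) j(2), of t "2 * a"] that a by auto
    have is_\<beta>: "p = j" "odd t" if "?x t p = \<beta>" "p \<in> {1..m}" for t p
      using label_determines_walk[OF that(2) j(1), of t "2 * b + 1"] that b by auto
    define g where "g = (\<lambda>l :: nat. (2 * l, Suc j, j))"
    define h where "h = (\<lambda>l :: nat. (2 * l + 1, j, Suc j))"
    have "E = g ` L1 \<union> h ` L2"
    proof (intro equalityI subsetI)
      fix s assume s: "s \<in> E"
      obtain t p q where tpq: "s = (t, p, q)" by (cases s) auto
      with s have t: "t < 2 * k" "p \<in> {1..m}" "q \<in> {1..m}" "{?x t p, ?x (Suc t) q} = {\<alpha>, \<beta>}"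
        by (auto simp: E_def slots_def)
      then consider "?x t p = \<alpha>" "?x (Suc t) q = \<beta>" | "?x t p = \<beta>" "?x (Suc t) q = \<alpha>"
        by (auto simp: doubleton_eq_iff)
      then show "s \<in> g ` L1 \<union> h ` L2"
      proof cases
        case 1
        then have pq: "p = Suc j" "q = j" "even t" using is_\<alpha> is_\<beta> t by auto
        then obtain l where "t = 2 * l" by (auto elim: evenE)
        then have "l \<in> L1" "s = g l" using 1 pq t tpq by (auto simp: L1_def g_def)
        then show ?thesis by blast
      next
        case 2
        then have pq: "p = j" "q = Suc j" "odd t" using is_\<alpha> is_\<beta> t by auto
        then obtain l where "t = 2 * l + 1" by (auto elim: oddE)
        then have "l \<in> L2" "s = h l" using 2 pq t tpq by (auto simp: L2_def h_def)
        then show ?thesis by blast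
      qed
    next
      fix s assume "s \<in> g ` L1 \<union> h ` L2"
      then show "s \<in> E"
      proof
        assume "s \<in> g ` L1"
        then show ?thesis using j by (auto simp: E_def slots_def L1_def g_def adj_def)
      next
        assume "s \<in> h ` L2"
        then show ?thesis using j by (auto simp: E_def slots_def L2_def h_def adj_def)
      qed
    qed
    moreover have "g ` L1 \<inter> h ` L2 = {}" by (auto simp: g_def h_def)
    ultimately have "card E = card (g ` L1) + card (h ` L2)" using fin by (simp add: card_Un_disjoint)
    also have "\<dots> = card L1 + card L2"
      by (intro arg_cong2[of _ _ _ _ "(+)"] card_image) (auto simp: g_def h_def inj_on_def)
    finally have "card E = card L1 + card L2" .
    moreover have "even_quotient m k R" using R by (simp add: extremal_def admissible_def)
    then have "even (card E)" unfolding even_quotient_slots[OF k] E_def by blast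
    ultimately show ?thesis by simp
  qed simp
  then show ?thesis by (simp add: L1_def L2_def)
qed

lemma classes_refine:
  assumes R: "R \<in> extremal m k" and k: "k \<ge> 1" and j: "j \<in> {1..m}" "j' \<in> {j..m}"
    and i: "i < k" "i' < k" and eq: "class_at k R (2 * i) j = class_at k R (2 * i') j"
  shows "class_at k R (2 * i) j' = class_at k R (2 * i') j'"
proof -
  interpret tight_walks m k "class_at k R" by (rule tight_walks_class_at[OF R k])
  have "j \<le> j'" using j by simp
  then have "j' \<le> m \<longrightarrow> class_at k R (2 * i) j' = class_at k R (2 * i') j'"
  proof (induction j' rule: dec_induct)
    case base
    then show ?case using eq by simp
  next
    case (step l)
    show ?case
    proof
      assume l: "Suc l \<le> m"
      then have l': "l \<in> {1..m}" "Suc l \<in> {1..m}" using step.hyps j by auto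
      have eq: "class_at k R (2 * i) l = class_at k R (2 * i') l" using step.IH l by simp
      have step': "class_at k R (2 * a) (Suc l) = class_at k R (2 * b) (Suc l)"
        if "a < b" "b < k" "class_at k R (2 * a) l = class_at k R (2 * b) l" for a b
        by (rule refinement[OF l'(1) that connecting_even[OF R k l']])
      show "class_at k R (2 * i) (Suc l) = class_at k R (2 * i') (Suc l)"
      proof (cases i i' rule: linorder_cases)
        case less
        then show ?thesis using step'[OF less i(2) eq] by simp
      next
        case greater
        then show ?thesis using step'[OF greater i(1) eq[symmetric]] by simp
      qed simp
    qed
  qed
  then show ?thesis using j by simp
qed

lemma chain_of_eq_iff:
  assumes "j \<in> {1..m}" "y < k" "y' < k"
  shows "chain_of m k R j y = chain_of m k R j y' \<longleftrightarrow> class_at k R (2 * y) j = class_at k R (2 * y') j"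
proof -
  have "class_at k R (2 * chain_of m k R j z) j = class_at k R (2 * z) j" if "z < k" for z
    using LeastI[of "\<lambda>u. class_at k R (2 * u) j = class_at k R (2 * z) j" z] assms that
    by (simp add: chain_of_def)
  note same = this
  show ?thesis
  proof
    assume "chain_of m k R j y = chain_of m k R j y'"
    then show "class_at k R (2 * y) j = class_at k R (2 * y') j"
      using same[OF assms(2)] same[OF assms(3)] by metis
  next
    assume "class_at k R (2 * y) j = class_at k R (2 * y') j"
    then show "chain_of m k R j y = chain_of m k R j y'" using assms by (simp add: chain_of_def)
  qed
qed

lemma chain_of_chains:
  assumes R: "R \<in> extremal m k" and k: "k \<ge> 1"
  shows "chain_of m k R \<in> noncrossing_chains m 0 k"
proof -
  interpret tight_walks m k "class_at k R" by (rule tight_walks_class_at[OF R k])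
  let ?x = "class_at k R" and ?b = "chain_of m k R"
  have le: "?b i y \<le> y" if "i \<in> {1..m}" "y < k" for i y
    using that by (simp add: chain_of_def Least_le)
  have same: "?x (2 * ?b i y) i = ?x (2 * y) i" if "i \<in> {1..m}" "y < k" for i y
    using LeastI[of "\<lambda>u. ?x (2 * u) i = ?x (2 * y) i" y] that by (simp add: chain_of_def)
  have least: "?b i y \<le> z" if "i \<in> {1..m}" "y < k" "?x (2 * z) i = ?x (2 * y) i" for i y z
    using Least_le[of "\<lambda>u. ?x (2 * u) i = ?x (2 * y) i" z] that by (simp add: chain_of_def)
  show ?thesis
  proof (rule noncrossing_chainsI)
    show "?b i y = 0" if "i \<notin> {1..m} \<or> y \<notin> {0..<k}" for i y using that by (auto simp: chain_of_def)
    show "0 \<le> ?b i y \<and> ?b i y \<le> y" if "i \<in> {1..m}" "y \<in> {0..<k}" for i y using le that by simp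
    show "?b i y \<le> ?b i z" if i: "i \<in> {1..m}" and *: "y \<in> {0..<k}" "?b i y \<le> z" "z \<le> y" for i y z
    proof (rule ccontr)
      assume "\<not> ?b i y \<le> ?b i z"
      then have lt: "?b i z < ?b i y" by simp
      have y: "y < k" "z < k" using * by auto
      have diff: "?x (2 * ?b i z) i \<noteq> ?x (2 * ?b i y) i"
        using least[OF i y(1), of "?b i z"] same[OF i y(1)] lt by auto
      have "?b i y \<noteq> z" using diff same[OF i y(2)] by auto
      moreover have "z \<noteq> y" using lt by auto
      ultimately have "?x (2 * ?b i z) i = ?x (2 * ?b i y) i"
        using noncrossing[OF i, of "2 * ?b i z" "2 * ?b i y" "2 * z" "2 * y"]
          lt * y same[OF i y(1)] same[OF i y(2)] by simp
      then show False using diff by simp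
    qed
    show "?b i' (?b i y) = ?b i' y" if i: "i \<in> {1..m}" and *: "y \<in> {0..<k}" "i' \<in> {i..m}" for i i' y
    proof -
      have y: "y < k" "?b i y < k" using * le[OF i, of y] by auto
      have "?x (2 * ?b i y) i' = ?x (2 * y) i'"
        using classes_refine[OF R k i *(2) y(2,1)] same[OF i y(1)] by simp
      then show ?thesis using chain_of_eq_iff[of i' m "?b i y" k y R] y i * by simp
    qed
  qed
qed

lemma cut_cong:
  assumes "\<And>s u. s < k \<Longrightarrow> u < k \<Longrightarrow> f s = f u \<longleftrightarrow> g s = g u"
  shows "cut k f i = cut k g i"
proof -
  have "(s \<le> i \<and> i < u \<and> u < k \<and> f s = f u) = (s \<le> i \<and> i < u \<and> u < k \<and> g s = g u)" for s u
  proof (cases "s \<le> i \<and> i < u \<and> u < k")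
    case True
    then show ?thesis using assms[of s u] by simp
  next
    case False
    then show ?thesis by blast
  qed
  then show ?thesis by (simp only: cut_def)
qed

lemma vertex_atE:
  assumes "v \<in> H_verts m k"
  obtains t i j where "v = vertex_at k t j" "j \<in> {1..m}" "i < k" "t = 2 * i \<or> t = 2 * i + 1"
proof -
  obtain i j where ij: "i \<in> {1..k}" "j \<in> {1..m}" "v = A i j \<or> v = B i j"
    using assms by (auto simp: H_verts_def)
  then have i: "i - 1 < k" "Suc (i - 1) = i" by auto
  from ij(3) show ?thesis
  proof
    assume "v = A i j"
    then show ?thesis using that[of "2 * (i - 1)" j "i - 1"] vertex_at_simps(1)[OF i(1), of j] ij i by simp
  next
    assume "v = B i j"
    then show ?thesis using that[of "2 * (i - 1) + 1" j "i - 1"] vertex_at_simps(2)[OF i(1), of j] ij i by simp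
  qed
qed

lemma partition_of_chain_of:
  assumes R: "R \<in> extremal m k" and k: "k \<ge> 1"
  shows "partition_of m k (chain_of m k R) = R"
proof -
  interpret tight_walks m k "class_at k R" by (rule tight_walks_class_at[OF R k])
  let ?x = "class_at k R" and ?b = "chain_of m k R" and ?V = "H_verts m k"
  have equiv: "equiv ?V R" using R by (simp add: extremal_def admissible_def)
  then have RV: "R \<subseteq> ?V \<times> ?V" by (auto simp: equiv_def refl_on_def)
  have "(v, w) \<in> R \<longleftrightarrow> colour k ?b v = colour k ?b w" if V: "v \<in> ?V" "w \<in> ?V" for v w
  proof -
    obtain t i j where v: "v = vertex_at k t j" "j \<in> {1..m}" "i < k" "t = 2 * i \<or> t = 2 * i + 1"
      using vertex_atE[OF V(1)] by metis
    obtain t' i' j' where w: "w = vertex_at k t' j'" "j' \<in> {1..m}" "i' < k" "t' = 2 * i' \<or> t' = 2 * i' + 1"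
      using vertex_atE[OF V(2)] by metis
    have R_iff: "(v, w) \<in> R \<longleftrightarrow> ?x t j = ?x t' j'"
      using class_at_eq_iff[OF equiv k v(2) w(2)] v(1) w(1) by simp
    have colA: "colour k ?b (vertex_at k (2 * i) j) = (True, j, {(?b j i, 0)})" if "i < k" for i j
      using that by (simp add: colour_def vertex_at_simps)
    have colB: "colour k ?b (vertex_at k (2 * i + 1) j) = (False, j, cut k (?b j) i)" if "i < k" for i j
      using that by (simp add: colour_def vertex_at_simps)
    show ?thesis
    proof (cases "j = j' \<and> (even t \<longleftrightarrow> even t')")
      case False
      then have "?x t j \<noteq> ?x t' j'" using label_determines_walk[OF v(2) w(2)] by blast
      moreover have "colour k ?b v \<noteq> colour k ?b w"
        using False v(1,4) w(1,4) colA[OF v(3)] colA[OF w(3)] colB[OF v(3)] colB[OF w(3)] by auto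
      ultimately show ?thesis using R_iff by simp
    next
      case True
      then have j': "j' = j" by simp
      show ?thesis
      proof (cases "even t")
        case even: True
        then have "t = 2 * i" "t' = 2 * i'" using True v(4) w(4) by auto
        then show ?thesis
          using R_iff chain_of_eq_iff[OF v(2,3) w(3), of R] colA[OF v(3)] colA[OF w(3)] v(1) w(1) j' by simp
      next
        case odd: False
        then have t: "t = 2 * i + 1" "t' = 2 * i' + 1" using True v(4) w(4) by auto
        have "cut k (?b j) l = cut k (\<lambda>i. ?x (2 * i) j) l" for l
          by (rule cut_cong) (rule chain_of_eq_iff[OF v(2)])
        then have "colour k ?b v = colour k ?b w \<longleftrightarrow> ?x t j = ?x t' j"
          using complement[OF v(2,3) w(3)] colB[OF v(3)] colB[OF w(3)] v(1) w(1) j' t by simp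
        then show ?thesis using R_iff j' by simp
      qed
    qed
  qed
  then show ?thesis using RV by (auto simp: partition_of_def)
qed

lemma card_class_images:
  assumes V: "finite V"
  shows "card (V // {(v, w) \<in> V \<times> V. c v = c w}) = card (c ` V)"
proof -
  let ?R = "{(v, w) \<in> V \<times> V. c v = c w}"
  have "V // ?R = (\<lambda>v. ?R `` {v}) ` V" by (auto simp: quotient_def)
  also have "\<dots> = (\<lambda>v. {w \<in> V. c w = c v}) ` V" by (rule image_cong) auto
  finally have "V // ?R = (\<lambda>y. {w \<in> V. c w = y}) ` c ` V" by (simp add: image_image)
  moreover have "inj_on (\<lambda>y. {w \<in> V. c w = y}) (c ` V)"
  proof (rule inj_onI, clarify)
    fix v w assume "v \<in> V" "{u \<in> V. c u = c v} = {u \<in> V. c u = c w}"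
    then show "c v = c w" by blast
  qed
  ultimately show ?thesis by (simp add: card_image)
qed

lemma chain_is_noncrossing_minimum:
  assumes "b \<in> noncrossing_chains m 0 k" "j \<in> {1..m}"
  shows "noncrossing_minimum k (b j)"
proof
  show "b j y \<le> y" if "y < k" for y
    using noncrossing_chainsD(2)[OF assms, of y] that by simp
  show "b j y \<le> b j z" if "y < k" "b j y \<le> z" "z \<le> y" for y z
    using noncrossing_chainsD(3)[OF assms, of y z] that by simp
qed

lemma class_at_partition_of:
  assumes k: "k \<ge> 1" and j: "j \<in> {1..m}"
  shows "class_at k (partition_of m k b) t j = {w \<in> H_verts m k. colour k b w = colour k b (vertex_at k t j)}"
proof -
  have "vertex_at k t j \<in> H_verts m k" using j by (auto simp: H_verts_vertex_at[OF k])
  then show ?thesis by (auto simp: class_at_def partition_of_def)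
qed

lemma separated_partition_of: "separated m k (partition_of m k b)"
  unfolding separated_def
proof (intro ballI impI notI)
  fix P u v assume P: "P \<in> pieces m k" "u \<in> P" "v \<in> P" and ne: "u \<noteq> v" and "(u, v) \<in> partition_of m k b"
  then have "colour k b u = colour k b v" by (simp add: partition_of_def)
  moreover obtain i i' where "P \<subseteq> range (A i) \<union> range (B i')"
    using P(1) unfolding pieces_def by blast
  then have "u \<in> range (A i) \<union> range (B i')" "v \<in> range (A i) \<union> range (B i')" using P by auto
  ultimately show False using ne by (auto simp: colour_def)
qed

text \<open>
  For each pair of indices \<open>j \<le> j'\<close> the permutation for the partition at level \<open>j\<close> pairs the edges from the
  \<open>a\<close>-vertices of walk \<open>j'\<close> to the \<open>b\<close>-vertices of walk \<open>j\<close> with those in the opposite direction: it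
  preserves the classes at level \<open>j\<close>, hence also those of the coarser level \<open>j'\<close>. This covers the steps
  of the walks (\<open>j' = j\<close>) and the connecting edges (\<open>j' = j + 1\<close>).
\<close>

lemma even_quotient_partition_of:
  assumes b: "b \<in> noncrossing_chains m 0 k" and k: "k \<ge> 1"
  shows "even_quotient m k (partition_of m k b)"
  unfolding even_quotient_slots[OF k]
proof
  fix e
  let ?x = "class_at k (partition_of m k b)"
  define F where "F t p q = (of_bool ({?x t p, ?x (Suc t) q} = e) :: nat)" for t p q
  have x_eq: "?x t j = ?x t' j" if "j \<in> {1..m}" "colour k b (vertex_at k t j) = colour k b (vertex_at k t' j)" for t t' j
    using that class_at_partition_of[OF k] by simp
  have pair: "even (\<Sum>i<k. F (2 * i) j' j + F (Suc (2 * i)) j j')"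
    if j: "j \<in> {1..m}" "j' \<in> {j..m}" for j j'
  proof -
    interpret noncrossing_minimum k "b j" by (rule chain_is_noncrossing_minimum[OF b j(1)])
    obtain \<sigma> where \<sigma>: "bij_betw \<sigma> {..<k} {..<k}" "\<And>i. i < k \<Longrightarrow> b j ((\<sigma> i + 1) mod k) = b j i"
      "\<And>i. i < k \<Longrightarrow> cut k (b j) (\<sigma> i) = cut k (b j) i"
      using exists_turning_permutation by auto
    have j': "j' \<in> {1..m}" using j by auto
    have "F (Suc (2 * \<sigma> i)) j j' = F (2 * i) j' j" if i: "i < k" for i
    proof -
      have si: "\<sigma> i < k" "(\<sigma> i + 1) mod k < k" using bij_betwE[OF \<sigma>(1)] i by auto
      have "b j' ((\<sigma> i + 1) mod k) = b j' (b j ((\<sigma> i + 1) mod k))"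
        using noncrossing_chainsD(4)[OF b j(1) _ j(2), of "(\<sigma> i + 1) mod k"] si by simp
      also have "\<dots> = b j' i"
        using noncrossing_chainsD(4)[OF b j(1) _ j(2), of i] i \<sigma>(2)[OF i] by simp
      finally have "?x (Suc (Suc (2 * \<sigma> i))) j' = ?x (2 * i) j'"
        using i by (intro x_eq[OF j']) (simp add: colour_def vertex_at_def)
      moreover have "?x (Suc (2 * \<sigma> i)) j = ?x (Suc (2 * i)) j"
        using i si \<sigma>(3)[OF i] by (intro x_eq[OF j(1)]) (simp add: colour_def vertex_at_simps)
      ultimately show ?thesis by (simp add: F_def insert_commute)
    qed
    then have "(\<Sum>i<k. F (2 * i) j' j) = (\<Sum>i<k. F (Suc (2 * \<sigma> i)) j j')" by simp
    also have "\<dots> = (\<Sum>i<k. F (Suc (2 * i)) j j')"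
      by (rule sum.reindex_bij_betw[OF \<sigma>(1)])
    finally show ?thesis by (simp add: sum.distrib)
  qed
  have "card {(t, p, q) \<in> slots m k. {?x t p, ?x (Suc t) q} = e} = (\<Sum>(t, p, q)\<in>slots m k. F t p q)"
    using finite_slots by (simp add: F_def case_prod_unfold of_bool_def sum.If_cases Int_def)
  also have "\<dots> = (\<Sum>j\<in>{1..m}. \<Sum>i<k. F (2 * i) j j + F (Suc (2 * i)) j j) +
    (\<Sum>j\<in>{1..<m}. \<Sum>i<k. F (2 * i) (Suc j) j + F (Suc (2 * i)) j (Suc j))"
    by (subst sum_slots, subst sum.distrib) (intro arg_cong2[of _ _ _ _ "(+)"] sum.swap)
  also have "even \<dots>"
    by (intro dvd_add dvd_sum pair) auto
  finally show "even (card {(t, p, q) \<in> slots m k. {?x t p, ?x (Suc t) q} = e})" .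
qed

lemma partition_of_extremal:
  assumes b: "b \<in> noncrossing_chains m 0 k" and k: "k \<ge> 1"
  shows "partition_of m k b \<in> extremal m k"
proof -
  let ?V = "H_verts m k"
  have "equiv ?V (partition_of m k b)"
    by (rule equivI) (auto simp: partition_of_def refl_on_def sym_def trans_def)
  then have adm: "partition_of m k b \<in> admissible m k"
    using separated_partition_of even_quotient_partition_of[OF assms] by (simp add: admissible_def)
  define I where "I j = (\<lambda>z. (True, j, {(z, 0)})) ` b j ` {..<k} \<union>
    (\<lambda>z. (False, j, z)) ` cut k (b j) ` {..<k}" for j :: nat
  have V: "?V = (\<Union>j\<in>{1..m}. (\<lambda>i. A (Suc i) j) ` {..<k} \<union> (\<lambda>i. B (Suc i) j) ` {..<k})"
  proof -
    have "{1..k} = Suc ` {..<k}" by (simp add: image_Suc_lessThan)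
    then show ?thesis unfolding H_verts_def by auto
  qed
  have "colour k b ` ?V = (\<Union>j\<in>{1..m}. I j)"
    unfolding V I_def image_UN image_Un image_image by (simp add: colour_def)
  also have "card \<dots> = (\<Sum>j\<in>{1..m}. card (I j))"
    by (rule card_UN_disjoint) (auto simp: I_def)
  also have "\<dots> = (\<Sum>j\<in>{1..m}. k + 1)"
  proof (rule sum.cong)
    fix j assume j: "j \<in> {1..m}"
    interpret noncrossing_minimum k "b j" by (rule chain_is_noncrossing_minimum[OF b j])
    have "card (I j) = card (b j ` {..<k}) + card (cut k (b j) ` {..<k})"
      unfolding I_def by (subst card_Un_disjoint) (auto simp: card_image inj_on_def)
    then show "card (I j) = k + 1" using card_blocks_complement[OF k] by simp
  qed simp
  finally have "card (colour k b ` ?V) = m * (k + 1)" by simp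
  then have "card (?V // partition_of m k b) = m * (k + 1)"
    unfolding partition_of_def card_class_images[OF finite_H_verts] .
  then show ?thesis using adm by (simp add: extremal_def)
qed

lemma chain_of_partition_of:
  assumes b: "b \<in> noncrossing_chains m 0 k" and k: "k \<ge> 1"
  shows "chain_of m k (partition_of m k b) = b"
proof (intro ext)
  fix j y
  let ?x = "class_at k (partition_of m k b)"
  show "chain_of m k (partition_of m k b) j y = b j y"
  proof (cases "j \<in> {1..m} \<and> y < k")
    case False
    then have "j \<notin> {1..m} \<or> y \<notin> {0..<k}" by auto
    then have "b j y = 0" by (rule noncrossing_chainsD(1)[OF b])
    moreover have "chain_of m k (partition_of m k b) j y = 0" using False unfolding chain_of_def by argo
    ultimately show ?thesis by simp
  next
    case True
    interpret noncrossing_minimum k "b j" by (rule chain_is_noncrossing_minimum[OF b]) (use True in simp)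
    have x_iff: "?x (2 * z) j = ?x (2 * y) j \<longleftrightarrow> b j z = b j y" if z: "z < k" for z
    proof -
      have v: "vertex_at k (2 * z) j \<in> H_verts m k" "vertex_at k (2 * y) j \<in> H_verts m k"
        using True unfolding H_verts_vertex_at[OF k] by blast+
      have x_eq: "?x (2 * u) j = {w \<in> H_verts m k. colour k b w = colour k b (vertex_at k (2 * u) j)}" for u
        using class_at_partition_of[OF k, of j m b "2 * u"] True by blast
      have "?x (2 * z) j = ?x (2 * y) j \<longleftrightarrow> colour k b (vertex_at k (2 * z) j) = colour k b (vertex_at k (2 * y) j)"
      proof
        assume eq: "?x (2 * z) j = ?x (2 * y) j"
        have "vertex_at k (2 * z) j \<in> ?x (2 * z) j" unfolding x_eq using v(1) by simp
        then have "vertex_at k (2 * z) j \<in> ?x (2 * y) j" by (simp only: eq)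
        then show "colour k b (vertex_at k (2 * z) j) = colour k b (vertex_at k (2 * y) j)"
          using x_eq[of y] by blast
      qed (simp only: x_eq)
      then show ?thesis using z True by (simp add: colour_def vertex_at_simps)
    qed
    have "(LEAST z. ?x (2 * z) j = ?x (2 * y) j) = b j y"
    proof (rule Least_equality)
      show "?x (2 * b j y) j = ?x (2 * y) j"
        using x_iff[of "b j y"] idem[of y] below[of y] True by simp
      fix z assume z: "?x (2 * z) j = ?x (2 * y) j"
      show "b j y \<le> z"
      proof (cases "z < k")
        case True
        then show ?thesis using z x_iff[OF True] below[OF True] by simp
      next
        case False
        then show ?thesis using below[of y] True by simp
      qed
    qed
    then show ?thesis using True by (simp add: chain_of_def)
  qed
qed

theorem card_extremal:
  assumes k: "k \<ge> 1"
  shows "card (extremal m k) = raney m k 1"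
proof -
  have "bij_betw (partition_of m k) (noncrossing_chains m 0 k) (extremal m k)"
    by (rule bij_betwI[of _ _ _ "chain_of m k"])
      (auto simp: partition_of_extremal[OF _ k] chain_of_chains[OF _ k]
        chain_of_partition_of[OF _ k] partition_of_chain_of[OF _ k])
  then show ?thesis using card_noncrossing_chains[of 0 k m] by (simp add: bij_betw_same_card)
qed

theorem theorem5p7:
  fixes m k :: nat
  assumes "m \<ge> 1" and "k \<ge> 1"
  shows "real (card (dominant_classes m k)) =
    1 / (real m * real k + 1) * real (((m + 1) * k) choose k)"
proof -
  have "(\<lambda>_ _. 0) \<in> noncrossing_chains m 0 k" by (rule noncrossing_chainsI) simp_all
  then have "partition_of m k (\<lambda>_ _. 0) \<in> extremal m k" by (rule partition_of_extremal[OF _ assms(2)])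
  then have "card (dominant_classes m k) = card (extremal m k)"
    unfolding extremal_def
    using card_classes_le[OF _ assms(2), of _ m] by (intro card_dominant_classes) blast+
  then show ?thesis using card_extremal[OF assms(2)] fuss_catalan by simp
qed

end
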